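(* Let $L$ and $K$ be finite connected abstract simplicial complexes and let $\varphi,\varphi'\colon L\to K$ be simplicial maps. Then the homotopic distance between the geometric realizations of $\varphi$ and $\varphi'$ equals the contiguity distance between $\varphi$ and $\varphi'$: $$\mathrm{D}(\|\varphi\|,\|\varphi'\|)=\mathrm{D}(\varphi,\varphi').$$
   Context: Complexes are finite, connected abstract simplicial complexes (subcomplexes are not required to be connected). $\|K\|$ denotes the geometric realization of $K$ and $\|\varphi\|$ that of a simplicial map $\varphi$. $\mathrm{Sd}^b(L)$ is the $b$-fold iterated barycentric subdivision of $L$ ($\mathrm{Sd}^0(L)=L$), and $\|\mathrm{Sd}^b(L)\|$ is identified with $\|L\|$ in the standard way. Homotopic distance: for continuous maps $f,g\colon X\to Y$, $\mathrm{D}(f,g)$ is one less than the minimal cardinality of covers of $X$ by open sets $U$ on each of which the restrictions $f_{|U}$ and $g_{|U}$ are homotopic (as maps $U\to Y$). Contiguity: simplicial maps $\varphi,\varphi'\colon J\to K$ are $1$-contiguous if $\varphi(\sigma)\cup\varphi'(\sigma)$ is a simplex of $K$ for every facet (maximal simplex) $\sigma$ of $J$. For a positive integer $c$ they are $c$-contiguous if there are simplicial maps $\varphi=\varphi_0,\varphi_1,\dots,\varphi_c=\varphi'\colon J\to K$ with $\varphi_{i-1}$ and $\varphi_i$ $1$-contiguous for each $1\le i\le c$. Simplicial approximation: for a simplex $\sigma$ of $K$, $\langle\sigma\rangle\subseteq\|K\|$ is the open realized simplex (barycentric combinations of the vertices of $\sigma$ with all coefficients positive) and $\|\sigma\|$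 is its closure. A simplicial map $\varphi\colon J\to K$ is a simplicial approximation of a continuous map $f\colon\|J\|\to\|K\|$ if $\|\varphi\|(x)\in\|\sigma\|$ whenever $f(x)\in\langle\sigma\rangle$. Strict contiguity distance: for simplicial maps $\varphi,\varphi'\colon L\to K$, $\mathrm{SD}_c(\varphi,\varphi')$ is one less than the smallest cardinality of finite covers of $L$ by subcomplexes $J$ for which $\varphi_{|J}$ and $\varphi'_{|J}$ are $c$-contiguous, and $\mathrm{SD}(\varphi,\varphi')=\lim_{c\to\infty}\mathrm{SD}_c(\varphi,\varphi')$, the eventual constant value of the non-increasing sequence $\mathrm{SD}_1\ge\mathrm{SD}_2\ge\cdots$. Contiguity distance: for each $b\ge1$ fix a simplicial approximation $\iota_b\colon\mathrm{Sd}^b(L)\to\mathrm{Sd}^{b-1}(L)$ of the identity on $\|L\|$. Put $\varphi_b=\varphi\circ\iota_1\circ\cdots\circ\iota_b$ and $\varphi'_b=\varphi'\circ\iota_1\circ\cdots\circ\iota_b$, as maps $\mathrm{Sd}^b(L)\to K$ (with $\varphi_0=\varphi$, $\varphi'_0=\varphi'$), and $\mathrm{SD}^b(\varphi,\varphi')=\mathrm{SD}(\varphi_b,\varphi'_b)$. This number does not depend on the chosen approximations $\iota_b$, and $\mathrm{SD}^0\ge\mathrm{SD}^1\ge\mathrm{SD}^2\ge\cdots\ge0$. The contiguity distance is $\mathrm{D}(\varphi,\varphi')=\lim_{b\to\infty}\mathrm{SD}^b(\varphi,\varphi')$, the eventual constant value of this sequence. *)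

theory Defs
  imports "HOL-Analysis.Analysis" "HOL-Library.FSet"
begin

section \<open>Finite simplicial complexes and their realizations\<close>

text \<open>The vertices of a complex \<open>K\<close> are the elements of \<open>\<Union>K\<close>. The empty complex is
  allowed here, so that it may occur as a subcomplex.\<close>

definition finite_complex :: "'a set set \<Rightarrow> bool" where
  "finite_complex K \<longleftrightarrow>
     finite K \<and> (\<forall>\<sigma>\<in>K. finite \<sigma> \<and> \<sigma> \<noteq> {}) \<and> (\<forall>\<sigma>\<in>K. \<forall>\<tau>. \<tau> \<subseteq> \<sigma> \<and> \<tau> \<noteq> {} \<longrightarrow> \<tau> \<in> K)"

definition subcomplex :: "'a set set \<Rightarrow> 'a set set \<Rightarrow> bool" where
  "subcomplex J K \<longleftrightarrow> finite_complex J \<and> J \<subseteq> K"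

text \<open>Connected complexes are nonempty by convention.\<close>

definition connected_complex :: "'a set set \<Rightarrow> bool" where
  "connected_complex K \<longleftrightarrow>
     K \<noteq> {} \<and> (\<forall>u\<in>\<Union>K. \<forall>v\<in>\<Union>K. (u, v) \<in> {(a, b). {a, b} \<in> K}\<^sup>*)"

text \<open>A simplicial map is a function on the whole vertex type; only its values on the vertices of
  the source complex matter.\<close>

definition simplicial_map :: "'a set set \<Rightarrow> 'b set set \<Rightarrow> ('a \<Rightarrow> 'b) \<Rightarrow> bool" where
  "simplicial_map J K \<phi> \<longleftrightarrow> (\<forall>\<sigma>\<in>J. \<phi> ` \<sigma> \<in> K)"

text \<open>Points of the realization are given by their barycentric coordinates. The type
  \<open>'a \<Rightarrow> real\<close> carries the product topology; for a finite complex the induced topology on the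
  realization is the usual one.\<close>

definition open_simplex :: "'a set \<Rightarrow> ('a \<Rightarrow> real) set" where
  "open_simplex \<sigma> = {x. (\<forall>v\<in>\<sigma>. 0 < x v) \<and> (\<forall>v. v \<notin> \<sigma> \<longrightarrow> x v = 0) \<and> (\<Sum>v\<in>\<sigma>. x v) = 1}"

definition closed_simplex :: "'a set \<Rightarrow> ('a \<Rightarrow> real) set" where
  "closed_simplex \<sigma> = closure (open_simplex \<sigma>)"

definition realization :: "'a set set \<Rightarrow> ('a \<Rightarrow> real) set" where
  "realization K = (\<Union>\<sigma>\<in>K. open_simplex \<sigma>)"

definition realization_map :: "'a set set \<Rightarrow> ('a \<Rightarrow> 'b) \<Rightarrow> ('a \<Rightarrow> real) \<Rightarrow> ('b \<Rightarrow> real)" where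
  "realization_map J \<phi> x = (\<lambda>w. \<Sum>v | v \<in> \<Union>J \<and> \<phi> v = w. x v)"


section \<open>Homotopic distance\<close>

text \<open>The value is \<open>\<infinity>\<close> if there is no finite cover of the required kind. Subtraction on
  \<^typ>\<open>enat\<close> truncates at \<open>0\<close>, which only matters for empty \<open>X\<close>.\<close>

definition homotopic_distance ::
  "'x topology \<Rightarrow> 'y topology \<Rightarrow> ('x \<Rightarrow> 'y) \<Rightarrow> ('x \<Rightarrow> 'y) \<Rightarrow> enat" where
  "homotopic_distance X Y f g =
     Inf {enat (card \<U>) | \<U>. finite \<U> \<and> \<Union>\<U> = topspace X \<and>
       (\<forall>U\<in>\<U>. openin X U \<and> homotopic_with (\<lambda>_. True) (subtopology X U) Y f g)} - 1"


section \<open>Contiguity and strict contiguity distance\<close>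

definition facet :: "'a set set \<Rightarrow> 'a set \<Rightarrow> bool" where
  "facet J \<sigma> \<longleftrightarrow> \<sigma> \<in> J \<and> (\<forall>\<tau>\<in>J. \<sigma> \<subseteq> \<tau> \<longrightarrow> \<tau> = \<sigma>)"

definition one_contiguous :: "'a set set \<Rightarrow> 'b set set \<Rightarrow> ('a \<Rightarrow> 'b) \<Rightarrow> ('a \<Rightarrow> 'b) \<Rightarrow> bool" where
  "one_contiguous J K \<phi> \<phi>' \<longleftrightarrow> simplicial_map J K \<phi> \<and> simplicial_map J K \<phi>' \<and>
     (\<forall>\<sigma>. facet J \<sigma> \<longrightarrow> \<phi> ` \<sigma> \<union> \<phi>' ` \<sigma> \<in> K)"

definition contiguous ::
  "nat \<Rightarrow> 'a set set \<Rightarrow> 'b set set \<Rightarrow> ('a \<Rightarrow> 'b) \<Rightarrow> ('a \<Rightarrow> 'b) \<Rightarrow> bool" where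
  "contiguous c J K \<phi> \<phi>' \<longleftrightarrow> 0 < c \<and>
     (\<exists>\<psi>. \<psi> 0 = \<phi> \<and> \<psi> c = \<phi>' \<and> (\<forall>i<c. one_contiguous J K (\<psi> i) (\<psi> (Suc i))))"

text \<open>The value is \<open>\<infinity>\<close> if no cover exists, which can happen for small \<open>c\<close>.\<close>

definition strict_contiguity_distance_at ::
  "nat \<Rightarrow> 'a set set \<Rightarrow> 'b set set \<Rightarrow> ('a \<Rightarrow> 'b) \<Rightarrow> ('a \<Rightarrow> 'b) \<Rightarrow> enat" where
  "strict_contiguity_distance_at c L K \<phi> \<phi>' =
     Inf {enat (card \<J>) | \<J>. finite \<J> \<and> \<Union>\<J> = L \<and>
       (\<forall>J\<in>\<J>. subcomplex J L \<and> contiguous c J K \<phi> \<phi>')} - 1"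

text \<open>The limits here and below are taken in the order topology of \<^typ>\<open>enat\<close>; as \<^typ>\<open>enat\<close> is
  well-ordered, a non-increasing sequence is eventually constant and the limit is that constant.\<close>

definition strict_contiguity_distance ::
  "'a set set \<Rightarrow> 'b set set \<Rightarrow> ('a \<Rightarrow> 'b) \<Rightarrow> ('a \<Rightarrow> 'b) \<Rightarrow> enat" where
  "strict_contiguity_distance L K \<phi> \<phi>' = lim (\<lambda>c. strict_contiguity_distance_at c L K \<phi> \<phi>')"


section \<open>Barycentric subdivision\<close>

text \<open>The vertices of a subdivision are the simplices of the subdivided complex. To keep all
  iterated subdivisions in one type, the simplex \<open>\<sigma>\<close>, regarded as a new vertex, is wrapped in
  the constructor \<open>Barycenter\<close>; original vertices are wrapped in \<open>Vertex\<close>.\<close>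

datatype 'a sd_vertex = Vertex (the_vertex: 'a) | Barycenter "'a sd_vertex fset"

definition barycenter :: "'a sd_vertex set \<Rightarrow> 'a sd_vertex" where
  "barycenter \<sigma> = Barycenter (Abs_fset \<sigma>)"

definition Sd :: "'a sd_vertex set set \<Rightarrow> 'a sd_vertex set set" where
  "Sd M = {barycenter ` C | C. C \<noteq> {} \<and> C \<subseteq> M \<and> chain\<^sub>\<subseteq> C}"

primrec Sd_iter :: "nat \<Rightarrow> 'a set set \<Rightarrow> 'a sd_vertex set set" where
  "Sd_iter 0 L = (\<lambda>\<sigma>. Vertex ` \<sigma>) ` L"
| "Sd_iter (Suc b) L = Sd (Sd_iter b L)"

text \<open>The standard identification of the realization of \<open>Sd M\<close> with that of \<open>M\<close>: the affine
  extension of the map sending the vertex \<open>barycenter \<sigma>\<close> to the barycentre of the simplex \<open>\<sigma>\<close>.\<close>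

definition Sd_identification ::
  "'a sd_vertex set set \<Rightarrow> ('a sd_vertex \<Rightarrow> real) \<Rightarrow> ('a sd_vertex \<Rightarrow> real)" where
  "Sd_identification M x = (\<lambda>v. \<Sum>\<sigma> | \<sigma> \<in> M \<and> v \<in> \<sigma>. x (barycenter \<sigma>) / real (card \<sigma>))"

definition simplicial_approximation ::
  "'a set set \<Rightarrow> 'b set set \<Rightarrow> (('a \<Rightarrow> real) \<Rightarrow> ('b \<Rightarrow> real)) \<Rightarrow> ('a \<Rightarrow> 'b) \<Rightarrow> bool" where
  "simplicial_approximation J K f \<phi> \<longleftrightarrow>
     continuous_map (top_of_set (realization J)) (top_of_set (realization K)) f \<and>
     simplicial_map J K \<phi> \<and>
     (\<forall>x\<in>realization J. \<forall>\<sigma>\<in>K. f x \<in> open_simplex \<sigma> \<longrightarrow>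
        realization_map J \<phi> x \<in> closed_simplex \<sigma>)"

text \<open>With \<open>\<parallel>Sd\<^sup>b L\<parallel>\<close> and \<open>\<parallel>Sd\<^sup>b\<^sup>-\<^sup>1 L\<parallel>\<close> both identified with \<open>\<parallel>L\<parallel>\<close>, the identity of \<open>\<parallel>L\<parallel>\<close> is the
  one-step identification between them.\<close>

definition approximations_of_identity ::
  "'a set set \<Rightarrow> (nat \<Rightarrow> 'a sd_vertex \<Rightarrow> 'a sd_vertex) \<Rightarrow> bool" where
  "approximations_of_identity L \<iota> \<longleftrightarrow>
     (\<forall>b\<ge>1. simplicial_approximation (Sd_iter b L) (Sd_iter (b - 1) L)
        (Sd_identification (Sd_iter (b - 1) L)) (\<iota> b))"


section \<open>Contiguity distance\<close>

text \<open>\<open>pullback \<iota> \<phi> b\<close> is \<open>\<phi> \<circ> \<iota> 1 \<circ> \<dots> \<circ> \<iota> b\<close>, with \<open>L\<close> identified with its copy \<open>Sd_iter 0 L\<close>.\<close>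

primrec pullback ::
  "(nat \<Rightarrow> 'a sd_vertex \<Rightarrow> 'a sd_vertex) \<Rightarrow> ('a \<Rightarrow> 'b) \<Rightarrow> nat \<Rightarrow> 'a sd_vertex \<Rightarrow> 'b" where
  "pullback \<iota> \<phi> 0 = \<phi> \<circ> the_vertex"
| "pullback \<iota> \<phi> (Suc b) = pullback \<iota> \<phi> b \<circ> \<iota> (Suc b)"

definition contiguity_distance ::
  "(nat \<Rightarrow> 'a sd_vertex \<Rightarrow> 'a sd_vertex) \<Rightarrow>
     'a set set \<Rightarrow> 'b set set \<Rightarrow> ('a \<Rightarrow> 'b) \<Rightarrow> ('a \<Rightarrow> 'b) \<Rightarrow> enat" where
  "contiguity_distance \<iota> L K \<phi> \<phi>' =
     lim (\<lambda>b. strict_contiguity_distance (Sd_iter b L) K (pullback \<iota> \<phi> b) (pullback \<iota> \<phi>' b))"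


section \<open>Existence of approximations of the identity\<close>

lemma barycenter_eq_iff:
  assumes "finite \<sigma>" "finite \<tau>"
  shows "barycenter \<sigma> = barycenter \<tau> \<longleftrightarrow> \<sigma> = \<tau>"
  using assms by (simp add: barycenter_def Abs_fset_inject)

lemma finite_complexD:
  assumes "finite_complex K"
  shows "finite K" "\<sigma> \<in> K \<Longrightarrow> finite \<sigma> \<and> \<sigma> \<noteq> {}"
    and "\<lbrakk>\<sigma> \<in> K; \<tau> \<subseteq> \<sigma>; \<tau> \<noteq> {}\<rbrakk> \<Longrightarrow> \<tau> \<in> K"
  using assms unfolding finite_complex_def by blast+

lemma finite_complex_Sd:
  assumes M: "finite_complex M"
  shows "finite_complex (Sd M)"
proof -
  have "Sd M \<subseteq> (\<lambda>C. barycenter ` C) ` Pow M"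
    by (auto simp: Sd_def)
  moreover have "finite M"
    using M by (simp add: finite_complex_def)
  ultimately have 1: "finite (Sd M)"
    by (meson finite_Pow_iff finite_imageI finite_subset)
  have 2: "finite \<sigma> \<and> \<sigma> \<noteq> {}" if "\<sigma> \<in> Sd M" for \<sigma>
    using that \<open>finite M\<close> by (auto simp: Sd_def intro: finite_subset)
  have 3: "\<tau> \<in> Sd M" if \<sigma>: "\<sigma> \<in> Sd M" and \<tau>: "\<tau> \<subseteq> \<sigma>" "\<tau> \<noteq> {}" for \<sigma> \<tau>
  proof -
    obtain C where C: "\<sigma> = barycenter ` C" "C \<subseteq> M" "chain\<^sub>\<subseteq> C"
      using \<sigma> unfolding Sd_def by blast
    then obtain D where D: "D \<subseteq> C" "\<tau> = barycenter ` D"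
      using \<tau> by (meson subset_imageE)
    have "D \<noteq> {}" "D \<subseteq> M"
      using C D \<tau> by auto
    moreover have "chain\<^sub>\<subseteq> D"
      using C(3) D(1) unfolding chain_subset_def by blast
    ultimately show ?thesis
      unfolding Sd_def using D(2) by blast
  qed
  show ?thesis
    unfolding finite_complex_def using 1 2 3 by blast
qed

lemma finite_complex_Sd_iter:
  assumes L: "finite_complex L"
  shows "finite_complex (Sd_iter b L)"
proof (induction b)
  case 0
  note fin = finite_complexD(1,2)[OF L] and down = finite_complexD(3)[OF L]
  have "\<tau> \<in> Sd_iter 0 L" if \<sigma>: "\<sigma> \<in> L" and \<tau>: "\<tau> \<subseteq> Vertex ` \<sigma>" "\<tau> \<noteq> {}" for \<sigma> \<tau>
  proof -
    obtain \<rho> where \<rho>: "\<rho> \<subseteq> \<sigma>" "\<tau> = Vertex ` \<rho>"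
      using \<tau> by (meson subset_imageE)
    then have "\<rho> \<in> L"
      using down[OF \<sigma>] \<tau> by blast
    with \<rho> show ?thesis
      by simp
  qed
  then have "\<forall>\<sigma>\<in>Sd_iter 0 L. \<forall>\<tau>. \<tau> \<subseteq> \<sigma> \<and> \<tau> \<noteq> {} \<longrightarrow> \<tau> \<in> Sd_iter 0 L"
    by (metis (no_types, lifting) Sd_iter.simps(1) imageE)
  moreover have "finite (Sd_iter 0 L)" "\<forall>\<sigma>\<in>Sd_iter 0 L. finite \<sigma> \<and> \<sigma> \<noteq> {}"
    using fin by auto
  ultimately show ?case
    unfolding finite_complex_def by blast
qed (simp add: finite_complex_Sd)

lemma in_closed_simplexI:
  assumes fin: "finite \<tau>" "\<tau> \<noteq> {}"
    and y: "\<And>v. 0 \<le> y v" "\<And>v. v \<notin> \<tau> \<Longrightarrow> y v = 0" "(\<Sum>v\<in>\<tau>. y v) = 1"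
  shows "y \<in> closed_simplex \<tau>"
proof -
  define g where
    "g = (\<lambda>t v. (1 - t) * y v + t * (if v \<in> \<tau> then 1 / real (card \<tau>) else 0))"
  have "continuous_on (closure {0<..<1::real}) g"
    unfolding g_def
    by (intro continuous_on_coordinatewise_then_product continuous_on_add continuous_on_mult
          continuous_on_diff continuous_on_const continuous_on_id)
  moreover have "g t \<in> open_simplex \<tau>" if t: "0 < t" "t < 1" for t
  proof -
    have "0 < g t v" if "v \<in> \<tau>" for v
    proof -
      have "0 \<le> (1 - t) * y v" "0 < t * (1 / real (card \<tau>))"
        using t y fin by (auto simp: card_gt_0_iff)
      then show ?thesis
        using that by (simp add: g_def)
    qed
    moreover have "g t v = 0" if "v \<notin> \<tau>" for v
      using that y by (simp add: g_def)
    moreover have "(\<Sum>v\<in>\<tau>. g t v) = 1"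
    proof -
      have "(\<Sum>v\<in>\<tau>. g t v) = (\<Sum>v\<in>\<tau>. (1 - t) * y v + t * (1 / real (card \<tau>)))"
        by (intro sum.cong) (auto simp: g_def)
      also have "\<dots> = 1"
        using y fin by (simp add: sum.distrib flip: sum_distrib_left)
      finally show ?thesis .
    qed
    ultimately show ?thesis
      by (auto simp: open_simplex_def)
  qed
  then have "g ` {0<..<1} \<subseteq> closure (open_simplex \<tau>)"
    using closure_subset by fastforce
  ultimately have "g ` closure {0<..<1} \<subseteq> closure (open_simplex \<tau>)"
    by (intro image_closure_subset) auto
  moreover have "g 0 = y"
    by (simp add: g_def)
  moreover have "0 \<in> closure {0<..<1::real}"
    by simp
  ultimately have "g 0 \<in> closure (open_simplex \<tau>)"
    by blast
  with \<open>g 0 = y\<close> show ?thesis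
    by (simp add: closed_simplex_def)
qed

lemma simplicial_approximation_Sd:
  assumes M: "finite_complex M"
    and \<iota>: "\<And>\<sigma>. \<sigma> \<in> M \<Longrightarrow> \<iota> (barycenter \<sigma>) \<in> \<sigma>"
  shows "simplicial_approximation (Sd M) M (Sd_identification M) \<iota>"
proof -
  note finM = finite_complexD(1)[OF M] and fin = finite_complexD(2)[OF M]
    and down = finite_complexD(3)[OF M]
  have top: "\<Union>C \<in> C" if "C \<subseteq> M" "C \<noteq> {}" "chain\<^sub>\<subseteq> C" for C
  proof -
    have "finite C"
      using that finM finite_subset by blast
    moreover have "A \<union> B \<in> C" if "A \<in> C" "B \<in> C" for A B
    proof -
      have "A \<subseteq> B \<or> B \<subseteq> A"
        using that \<open>chain\<^sub>\<subseteq> C\<close> unfolding chain_subset_def by blast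
      then show ?thesis
        using that by (metis sup.absorb1 sup.absorb2)
    qed
    ultimately show ?thesis
      using \<open>C \<noteq> {}\<close> by (intro finite_Sup_in)
  qed
  have img: "\<iota> ` barycenter ` C \<subseteq> \<Union>C" if "C \<subseteq> M" for C
    using that \<iota> by blast
  have simp: "simplicial_map (Sd M) M \<iota>"
    unfolding simplicial_map_def
  proof
    fix \<rho> assume "\<rho> \<in> Sd M"
    then obtain C where C: "\<rho> = barycenter ` C" "C \<subseteq> M" "C \<noteq> {}" "chain\<^sub>\<subseteq> C"
      by (auto simp: Sd_def)
    then show "\<iota> ` \<rho> \<in> M"
      using down[of "\<Union>C" "\<iota> ` \<rho>"] top[of C] img[of C] by blast
  qed
  have main: "Sd_identification M x \<in> open_simplex (\<Union>C) \<and>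
      realization_map (Sd M) \<iota> x \<in> closed_simplex (\<Union>C)"
    if C: "C \<subseteq> M" "C \<noteq> {}" "chain\<^sub>\<subseteq> C" and x: "x \<in> open_simplex (barycenter ` C)" for C x
  proof -
    have tM: "\<Union>C \<in> M" and finC: "finite C"
      using top[of C] C finM finite_subset by blast+
    have inj: "inj_on barycenter M"
      using fin by (auto simp: inj_on_def barycenter_eq_iff)
    have pos: "0 < x (barycenter \<sigma>)" if "\<sigma> \<in> C" for \<sigma>
      using x that by (auto simp: open_simplex_def)
    have zero: "x (barycenter \<sigma>) = 0" if "\<sigma> \<in> M" "\<sigma> \<notin> C" for \<sigma>
      using x that C inj by (auto simp: open_simplex_def inj_on_image_mem_iff)
    have nonneg: "0 \<le> x w" for w
      using x by (cases "w \<in> barycenter ` C") (auto simp: open_simplex_def less_imp_le)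
    have total: "(\<Sum>\<sigma>\<in>C. x (barycenter \<sigma>)) = 1"
      using x C inj by (simp add: open_simplex_def sum.reindex inj_on_subset)
    have h: "Sd_identification M x v = (\<Sum>\<sigma> | \<sigma> \<in> C \<and> v \<in> \<sigma>. x (barycenter \<sigma>) / real (card \<sigma>))" for v
      unfolding Sd_identification_def using C finM zero by (intro sum.mono_neutral_right) auto
    have "0 < Sd_identification M x v" if "v \<in> \<Union>C" for v
      unfolding h using that finC pos C fin
      by (intro sum_pos) (auto intro!: divide_pos_pos simp: card_gt_0_iff subset_eq)
    moreover have "Sd_identification M x v = 0" if "v \<notin> \<Union>C" for v
      unfolding h using that by (intro sum.neutral) auto
    moreover have "(\<Sum>v\<in>\<Union>C. Sd_identification M x v) = 1"
    proof -
      have "(\<Sum>v\<in>\<Union>C. Sd_identification M x v)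
          = (\<Sum>v\<in>\<Union>C. \<Sum>\<sigma> | \<sigma> \<in> C \<and> v \<in> \<sigma>. x (barycenter \<sigma>) / real (card \<sigma>))"
        by (simp add: h)
      also have "\<dots> = (\<Sum>\<sigma>\<in>C. \<Sum>v | v \<in> \<Union>C \<and> v \<in> \<sigma>. x (barycenter \<sigma>) / real (card \<sigma>))"
        using tM fin finC by (intro sum.swap_restrict) auto
      also have "\<dots> = (\<Sum>\<sigma>\<in>C. x (barycenter \<sigma>))"
      proof (intro sum.cong refl)
        fix \<sigma> assume s: "\<sigma> \<in> C"
        then have "{v. v \<in> \<Union>C \<and> v \<in> \<sigma>} = \<sigma>"
          by auto
        then show "(\<Sum>v | v \<in> \<Union>C \<and> v \<in> \<sigma>. x (barycenter \<sigma>) / real (card \<sigma>)) = x (barycenter \<sigma>)"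
          using s C fin by (auto simp: subset_eq)
      qed
      finally show ?thesis
        using total by simp
    qed
    ultimately have 1: "Sd_identification M x \<in> open_simplex (\<Union>C)"
      by (auto simp: open_simplex_def)
    have r: "realization_map (Sd M) \<iota> x w = (\<Sum>v | v \<in> barycenter ` C \<and> \<iota> v = w. x v)" for w
      unfolding realization_map_def
    proof (intro sum.mono_neutral_right)
      show "finite {v \<in> \<Union>(Sd M). \<iota> v = w}"
        using finite_complexD(1,2)[OF finite_complex_Sd[OF M]] by simp
      have "barycenter ` C \<in> Sd M"
        using C by (auto simp: Sd_def)
      then show "{v \<in> barycenter ` C. \<iota> v = w} \<subseteq> {v \<in> \<Union>(Sd M). \<iota> v = w}"
        by auto
    qed (use x in \<open>auto simp: open_simplex_def\<close>)
    have 2: "realization_map (Sd M) \<iota> x \<in> closed_simplex (\<Union>C)"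
    proof (rule in_closed_simplexI)
      show "finite (\<Union>C)" "\<Union>C \<noteq> {}"
        using fin[OF tM] by auto
      show "0 \<le> realization_map (Sd M) \<iota> x w" for w
        unfolding r using nonneg by (intro sum_nonneg) auto
      show "realization_map (Sd M) \<iota> x w = 0" if "w \<notin> \<Union>C" for w
        unfolding r using that img[OF C(1)] by (intro sum.neutral) blast
      have "(\<Sum>w\<in>\<Union>C. realization_map (Sd M) \<iota> x w) = (\<Sum>v\<in>barycenter ` C. x v)"
        unfolding r using finC fin[OF tM] img[OF C(1)] by (intro sum.group) auto
      then show "(\<Sum>w\<in>\<Union>C. realization_map (Sd M) \<iota> x w) = 1"
        using x by (simp add: open_simplex_def)
    qed
    from 1 2 show ?thesis ..
  qed
  have uniq: "\<sigma> = \<tau>" if "y \<in> open_simplex \<sigma>" "y \<in> open_simplex \<tau>" for y and \<sigma> \<tau> :: "'a sd_vertex set"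
  proof -
    have "\<rho> = {v. 0 < y v}" if "y \<in> open_simplex \<rho>" for \<rho>
      using that by (force simp: open_simplex_def)
    then show ?thesis
      using that by blast
  qed
  have chain: "\<exists>C. C \<subseteq> M \<and> C \<noteq> {} \<and> chain\<^sub>\<subseteq> C \<and> x \<in> open_simplex (barycenter ` C)"
    if "x \<in> realization (Sd M)" for x
    using that by (auto simp: realization_def Sd_def)
  have "continuous_on (realization (Sd M)) (Sd_identification M)"
    unfolding Sd_identification_def
    unfolding divide_inverse
    by (intro continuous_on_coordinatewise_then_product continuous_on_sum continuous_on_mult
          continuous_on_const continuous_on_subset[OF continuous_on_product_coordinates]) auto
  moreover have "Sd_identification M \<in> realization (Sd M) \<rightarrow> realization M"
  proof
    fix x assume "x \<in> realization (Sd M)"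
    then obtain C where C: "C \<subseteq> M" "C \<noteq> {}" "chain\<^sub>\<subseteq> C" "x \<in> open_simplex (barycenter ` C)"
      using chain by blast
    then have "Sd_identification M x \<in> open_simplex (\<Union>C)" "\<Union>C \<in> M"
      using main[of C x] top[of C] by blast+
    then show "Sd_identification M x \<in> realization M"
      unfolding realization_def by blast
  qed
  ultimately have "continuous_map (top_of_set (realization (Sd M))) (top_of_set (realization M))
      (Sd_identification M)"
    by (simp add: image_subset_iff_funcset)
  moreover have "realization_map (Sd M) \<iota> x \<in> closed_simplex \<sigma>"
    if x: "x \<in> realization (Sd M)" and \<sigma>: "Sd_identification M x \<in> open_simplex \<sigma>" for x \<sigma>
  proof -
    obtain C where C: "C \<subseteq> M" "C \<noteq> {}" "chain\<^sub>\<subseteq> C" "x \<in> open_simplex (barycenter ` C)"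
      using chain[OF x] by blast
    have m: "Sd_identification M x \<in> open_simplex (\<Union>C)"
        "realization_map (Sd M) \<iota> x \<in> closed_simplex (\<Union>C)"
      using main[OF C] by blast+
    show ?thesis
      using m(2) uniq[OF m(1) \<sigma>] by simp
  qed
  ultimately show ?thesis
    using simp by (auto simp: simplicial_approximation_def)
qed

theorem ex_approximations_of_identity:
  assumes L: "finite_complex L"
  shows "\<exists>\<iota>. approximations_of_identity L \<iota>"
proof -
  define \<kappa> :: "'a sd_vertex \<Rightarrow> 'a sd_vertex" where
    "\<kappa> w = (case w of Barycenter S \<Rightarrow> (SOME v. v \<in> fset S) | Vertex a \<Rightarrow> Vertex a)" for w
  have \<kappa>: "\<kappa> (barycenter \<sigma>) \<in> \<sigma>" if "finite \<sigma>" "\<sigma> \<noteq> {}" for \<sigma>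
    using that by (simp add: \<kappa>_def barycenter_def Abs_fset_inverse some_in_eq)
  have *: "simplicial_approximation (Sd_iter (Suc b) L) (Sd_iter b L)
      (Sd_identification (Sd_iter b L)) \<kappa>" for b
    using finite_complexD(2)[OF finite_complex_Sd_iter[OF L, of b]] \<kappa>
    by (simp add: simplicial_approximation_Sd finite_complex_Sd_iter[OF L])
  have "approximations_of_identity L (\<lambda>_. \<kappa>)"
    unfolding approximations_of_identity_def
  proof (intro allI impI)
    fix b :: nat assume "1 \<le> b"
    then have "b = Suc (b - 1)"
      by simp
    then show "simplicial_approximation (Sd_iter b L) (Sd_iter (b - 1) L)
        (Sd_identification (Sd_iter (b - 1) L)) \<kappa>"
      using * by metis
  qed
  then show ?thesis
    by blast
qed

end

theory Submission
  imports Defs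
begin

text \<open>The theorem compares two kinds of covers: open covers of \<open>\<parallel>L\<parallel>\<close> on whose members \<open>\<parallel>\<phi>\<parallel>\<close>
  and \<open>\<parallel>\<phi>'\<parallel>\<close> are homotopic, and covers of \<open>Sd\<^sup>b L\<close> by subcomplexes on which the pullbacks \<open>\<phi>\<^sub>b\<close>
  and \<open>\<phi>'\<^sub>b\<close> are contiguous. A cover of either kind yields one of the other kind with no more members,
  the passage from open sets to subcomplexes being possible for all large \<open>b\<close>. So the
  homotopic distance is a lower bound for every \<open>SD\<^sub>c(\<phi>\<^sub>b, \<phi>'\<^sub>b)\<close>, and these numbers equal it as soon as \<open>b\<close>
  and \<open>c\<close> are large. Both limits are then limits of eventually constant sequences.

  From subcomplexes to open sets (\<open>open_cover_of_subcomplex_cover\<close>). Contiguous maps are homotopic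
  on \<open>\<parallel>J\<parallel>\<close> by straight lines, but \<open>\<parallel>J\<parallel>\<close> is closed, and it lives in \<open>\<parallel>Sd\<^sup>b L\<parallel>\<close> instead of \<open>\<parallel>L\<parallel>\<close>. Both
  obstacles are overcome with one explicit construction. For a point \<open>x\<close> of \<open>\<parallel>M\<parallel>\<close> the simplices
  that are strict superlevel sets of the coordinates of \<open>x\<close> form a chain, and \<open>peak\<close> gives them continuous
  positive weights. Placing the weight of \<open>\<sigma>\<close> at the barycentre of \<open>\<sigma>\<close> gives a map \<open>\<parallel>M\<parallel> \<rightarrow> \<parallel>Sd M\<parallel>\<close>;
  placing it at a vertex of \<open>\<sigma>\<close>, for \<open>\<sigma> \<in> J\<close> only, gives a map to \<open>\<parallel>J\<parallel>\<close> from an open set.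
  In both cases points stay in their simplices of \<open>M\<close>, the first map being
  followed by \<open>\<parallel>\<iota>\<parallel>\<close>. Two maps into \<open>\<parallel>K\<parallel>\<close> whose values always share a simplex are homotopic
  (\<open>homotopic_if_common_simplex\<close>), and this gives all the homotopies.

  From open sets to subcomplexes (\<open>subcomplex_cover_of_open_cover\<close>). This is the classical argument by
  simplicial approximation. The simplices of \<open>Sd\<^sup>b L\<close> become uniformly small in \<open>\<parallel>L\<parallel>\<close>
  (\<open>mesh_Sd_iter\<close>), so each of them lies well inside a member of the open cover. For a
  given homotopy, short time steps and a fine subdivision give vertex maps
  that approximate the homotopy at both ends of a time step, and approximations of the same map are
  contiguous (\<open>contiguous_if_homotopic\<close>).\<close>

section \<open>Points of a realization and their supports\<close>

definition support :: "('v \<Rightarrow> real) \<Rightarrow> 'v set" where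
  "support x = {v. x v \<noteq> 0}"

lemma open_simplex_support:
  assumes "x \<in> open_simplex \<sigma>"
  shows "support x = \<sigma>"
  using assms by (force simp: open_simplex_def support_def)

lemma finite_vertices:
  assumes "finite_complex K"
  shows "finite (\<Union>K)"
  using finite_complexD(1,2)[OF assms] by blast

lemma realization_iff:
  assumes K: "finite_complex K"
  shows "x \<in> realization K \<longleftrightarrow> (\<forall>v. 0 \<le> x v) \<and> support x \<in> K \<and> (\<Sum>v\<in>\<Union>K. x v) = 1"
proof
  assume "x \<in> realization K"
  then obtain \<sigma> where \<sigma>: "\<sigma> \<in> K" "x \<in> open_simplex \<sigma>"
    by (auto simp: realization_def)
  have "(\<Sum>v\<in>\<Union>K. x v) = (\<Sum>v\<in>\<sigma>. x v)"
    using \<sigma> finite_vertices[OF K]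
    by (intro sum.mono_neutral_right) (auto simp: open_simplex_def)
  then show "(\<forall>v. 0 \<le> x v) \<and> support x \<in> K \<and> (\<Sum>v\<in>\<Union>K. x v) = 1"
    using \<sigma> open_simplex_support[OF \<sigma>(2)] by (auto simp: open_simplex_def) (metis less_imp_le order_refl)
next
  assume r: "(\<forall>v. 0 \<le> x v) \<and> support x \<in> K \<and> (\<Sum>v\<in>\<Union>K. x v) = 1"
  have "(\<Sum>v\<in>\<Union>K. x v) = (\<Sum>v\<in>support x. x v)"
    using r finite_vertices[OF K]
    by (intro sum.mono_neutral_right) (auto simp: support_def)
  then have "x \<in> open_simplex (support x)"
    using r by (auto simp: open_simplex_def support_def less_le)
  then show "x \<in> realization K"
    using r by (auto simp: realization_def)
qed

lemma realizationI:
  assumes K: "finite_complex K" and \<sigma>: "\<sigma> \<in> K" "support x \<subseteq> \<sigma>"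
    and x: "\<And>v. 0 \<le> x v" "(\<Sum>v\<in>\<Union>K. x v) = 1"
  shows "x \<in> realization K"
proof -
  have "support x \<noteq> {}"
  proof
    assume "support x = {}"
    then have "x v = 0" for v
      by (auto simp: support_def)
    with x(2) show False
      by simp
  qed
  then have "support x \<in> K"
    using finite_complexD(3)[OF K \<sigma>] by simp
  then show ?thesis
    using x by (simp add: realization_iff[OF K])
qed

text \<open>The barycentre of \<open>\<sigma>\<close>. It serves as a test point that turns statements about points into
  statements about simplices.\<close>

lemma ex_point_with_support:
  assumes K: "finite_complex K" and \<sigma>: "\<sigma> \<in> K"
  obtains x where "x \<in> realization K" "support x = \<sigma>"
proof -
  define x where "x v = (if v \<in> \<sigma> then 1 / real (card \<sigma>) else 0)" for v
  have f: "finite \<sigma>" "\<sigma> \<noteq> {}"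
    using finite_complexD(2)[OF K \<sigma>] by auto
  have "x \<in> open_simplex \<sigma>"
    using f by (auto simp: open_simplex_def x_def card_gt_0_iff)
  then show ?thesis
    using that \<sigma> open_simplex_support unfolding realization_def by blast
qed

lemma realization_coordinate_eq_0:
  assumes "finite_complex K" "x \<in> realization K" "v \<notin> \<Union>K"
  shows "x v = 0"
  using assms by (auto simp: realization_iff support_def)

lemma realization_subcomplex:
  assumes "subcomplex J M"
  shows "realization J \<subseteq> realization M"
  using assms by (auto simp: subcomplex_def realization_def)

text \<open>All coordinates of a point are nonnegative, so nothing cancels in the sums that define the
  image point. Supports of image points can thus be computed combinatorially.\<close>

lemma realization_map_support:
  assumes M: "finite_complex M" and x: "x \<in> realization M"
  shows "support (realization_map M \<phi> x) = \<phi> ` support x"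
proof -
  have fin: "finite (\<Union>M)" by (rule finite_vertices[OF M])
  have nn: "0 \<le> x v" for v
    using x by (simp add: realization_iff[OF M])
  have sub: "support x \<subseteq> \<Union>M"
    using x by (auto simp: realization_iff[OF M])
  have "realization_map M \<phi> x w = 0 \<longleftrightarrow> w \<notin> \<phi> ` support x" for w
    unfolding realization_map_def using fin nn sub
    by (subst sum_nonneg_eq_0_iff) (auto simp: support_def simp del: Union_iff)
  then show ?thesis
    by (auto simp: support_def)
qed

lemma realization_map_in_realization:
  assumes M: "finite_complex M" and K: "finite_complex K"
    and x: "x \<in> realization M" and \<phi>: "\<phi> ` support x \<in> K"
  shows "realization_map M \<phi> x \<in> realization K"
proof -
  have fin: "finite (\<Union>M)" "finite (\<Union>K)"
    using M K by (simp_all add: finite_vertices)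
  have xs: "0 \<le> x v" "support x \<subseteq> \<Union>M" "(\<Sum>v\<in>\<Union>M. x v) = 1" for v
    using x by (auto simp: realization_iff[OF M])
  have "(\<Sum>v\<in>\<Union>M. x v) = (\<Sum>v\<in>support x. x v)"
    using xs fin by (intro sum.mono_neutral_right) (auto simp: support_def)
  also have "\<dots> = (\<Sum>w\<in>\<Union>K. \<Sum>v | v \<in> support x \<and> \<phi> v = w. x v)"
    using xs fin \<phi> by (intro sum.group[symmetric]) (auto intro: finite_subset)
  also have "\<dots> = (\<Sum>w\<in>\<Union>K. realization_map M \<phi> x w)"
    unfolding realization_map_def using xs fin
    by (intro sum.cong refl sum.mono_neutral_left)
      (auto simp: support_def subset_iff simp del: Union_iff)
  finally have "(\<Sum>w\<in>\<Union>K. realization_map M \<phi> x w) = 1"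
    using xs by simp
  moreover have "0 \<le> realization_map M \<phi> x w" for w
    unfolding realization_map_def using xs by (intro sum_nonneg) auto
  ultimately show ?thesis
    using \<phi> realization_map_support[OF M x, of \<phi>] by (simp add: realization_iff[OF K])
qed

lemma continuous_map_realization:
  assumes "\<And>w. continuous_map X euclideanreal (\<lambda>x. f x w)"
    and "\<And>x. x \<in> topspace X \<Longrightarrow> f x \<in> realization K"
  shows "continuous_map X (top_of_set (realization K)) f"
  using assms
  by (auto simp: continuous_map_in_subtopology continuous_map_componentwise_UNIV
      simp flip: euclidean_product_topology)

lemma continuous_map_coordinate:
  assumes "continuous_map X (top_of_set (realization K)) f"
  shows "continuous_map X euclideanreal (\<lambda>x. f x w)"
  using assms
  by (auto simp: continuous_map_in_subtopology continuous_map_componentwise_UNIV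
      simp flip: euclidean_product_topology)

lemma continuous_map_in:
  assumes "continuous_map X (top_of_set S) f" "x \<in> topspace X"
  shows "f x \<in> S"
  using assms by (auto simp: continuous_map_in_subtopology)

lemma continuous_realization_map:
  assumes M: "finite_complex M" and K: "finite_complex K" and \<phi>: "simplicial_map M K \<phi>"
    and f: "continuous_map X (top_of_set (realization M)) f"
  shows "continuous_map X (top_of_set (realization K)) (realization_map M \<phi> \<circ> f)"
proof (rule continuous_map_realization)
  show "continuous_map X euclideanreal (\<lambda>x. (realization_map M \<phi> \<circ> f) x w)" for w
    unfolding realization_map_def o_def using finite_vertices[OF M]
    by (intro continuous_map_sum continuous_map_coordinate[OF f]) (auto simp del: Union_iff)
  show "(realization_map M \<phi> \<circ> f) x \<in> realization K" if "x \<in> topspace X" for x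
  proof -
    have "f x \<in> realization M"
      using continuous_map_in[OF f that] .
    moreover from this have "\<phi> ` support (f x) \<in> K"
      using \<phi> by (auto simp: realization_iff[OF M] simplicial_map_def)
    ultimately show ?thesis
      by (simp add: realization_map_in_realization[OF M K])
  qed
qed

section \<open>Homotopies along straight lines\<close>

text \<open>The segment between two points of a common simplex stays inside that simplex, so the
  straight-line homotopy never leaves \<open>\<parallel>K\<parallel>\<close>. Every homotopy that the proof constructs is of this
  kind or a composite of such homotopies.\<close>

lemma homotopic_if_common_simplex:
  assumes K: "finite_complex K"
    and f: "continuous_map X (top_of_set (realization K)) f"
    and g: "continuous_map X (top_of_set (realization K)) g"
    and common: "\<And>x. x \<in> topspace X \<Longrightarrow> \<exists>\<sigma>\<in>K. support (f x) \<subseteq> \<sigma> \<and> support (g x) \<subseteq> \<sigma>"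
  shows "homotopic_with (\<lambda>_. True) X (top_of_set (realization K)) f g"
proof -
  define h where "h = (\<lambda>(t::real, x) w. (1 - t) * f x w + t * g x w)"
  let ?T = "prod_topology (top_of_set {0..1}) X"
  have "continuous_map ?T (top_of_set (realization K)) h"
  proof (rule continuous_map_realization)
    have fst: "continuous_map ?T euclideanreal fst"
      using continuous_map_fst[of "top_of_set {0..1::real}" X]
      by (auto simp: continuous_map_in_subtopology)
    have snd: "continuous_map ?T euclideanreal (\<lambda>p. u (snd p) w)"
      if "continuous_map X (top_of_set (realization K)) u" for u w
      using continuous_map_compose[OF continuous_map_snd continuous_map_coordinate[OF that]]
      by (simp add: o_def)
    have one: "continuous_map ?T euclideanreal (\<lambda>_. 1)"
      by simp
    show "continuous_map ?T euclideanreal (\<lambda>p. h p w)" for w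
      unfolding h_def case_prod_unfold
      by (intro continuous_map_add continuous_map_real_mult continuous_map_diff fst one
            snd[OF f] snd[OF g])
    show "h p \<in> realization K" if p: "p \<in> topspace ?T" for p
    proof -
      obtain t x where tx: "p = (t, x)" "0 \<le> t" "t \<le> 1" "x \<in> topspace X"
        using p by auto
      have fx: "f x \<in> realization K" and gx: "g x \<in> realization K"
        using continuous_map_in f g tx by metis+
      obtain \<sigma> where \<sigma>: "\<sigma> \<in> K" "support (f x) \<subseteq> \<sigma>" "support (g x) \<subseteq> \<sigma>"
        using common tx by blast
      show ?thesis
      proof (rule realizationI[OF K \<sigma>(1)])
        show "support (h p) \<subseteq> \<sigma>"
          using \<sigma>(2,3) unfolding support_def h_def tx by force
        show "0 \<le> h p v" for v
          using fx gx tx by (simp add: h_def realization_iff[OF K])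
        show "(\<Sum>v\<in>\<Union>K. h p v) = 1"
          using fx gx by (simp add: h_def tx realization_iff[OF K] sum.distrib flip: sum_distrib_left)
      qed
    qed
  qed
  then show ?thesis
    unfolding homotopic_with_def by (intro exI[of _ h]) (auto simp: h_def)
qed

lemma simplex_in_facet:
  assumes J: "finite_complex J" and \<sigma>: "\<sigma> \<in> J"
  shows "\<exists>\<tau>. facet J \<tau> \<and> \<sigma> \<subseteq> \<tau>"
proof -
  have "finite J"
    using finite_complexD(1)[OF J] .
  then obtain \<tau> where "\<tau> \<in> J" "\<sigma> \<subseteq> \<tau>" "\<forall>\<rho>\<in>J. \<tau> \<subseteq> \<rho> \<longrightarrow> \<tau> = \<rho>"
    using finite_has_maximal2[OF _ \<sigma>] by metis
  then show ?thesis
    unfolding facet_def by metis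
qed

text \<open>The condition on facets passes to all simplices because every simplex lies in a facet and \<open>K\<close>
  is closed under passing to faces.\<close>

lemma one_contiguousD:
  assumes J: "finite_complex J" and K: "finite_complex K"
    and c: "one_contiguous J K \<phi> \<psi>" and \<sigma>: "\<sigma> \<in> J"
  shows "\<phi> ` \<sigma> \<union> \<psi> ` \<sigma> \<in> K"
proof -
  obtain \<tau> where \<tau>: "facet J \<tau>" "\<sigma> \<subseteq> \<tau>"
    using simplex_in_facet[OF J \<sigma>] by blast
  then have "\<phi> ` \<tau> \<union> \<psi> ` \<tau> \<in> K"
    using c by (auto simp: one_contiguous_def)
  moreover have "\<phi> ` \<sigma> \<union> \<psi> ` \<sigma> \<subseteq> \<phi> ` \<tau> \<union> \<psi> ` \<tau>" "\<phi> ` \<sigma> \<union> \<psi> ` \<sigma> \<noteq> {}"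
    using \<tau> finite_complexD(2)[OF J \<sigma>] by auto
  ultimately show ?thesis
    using finite_complexD(3)[OF K] by blast
qed

lemma one_contiguous_refl:
  assumes "simplicial_map J K \<phi>"
  shows "one_contiguous J K \<phi> \<phi>"
  using assms by (auto simp: one_contiguous_def simplicial_map_def facet_def)

lemma contiguous_simplicial:
  assumes "contiguous c J K \<phi> \<psi>"
  shows "simplicial_map J K \<phi>" "simplicial_map J K \<psi>"
proof -
  obtain \<theta> where t: "0 < c" "\<theta> 0 = \<phi>" "\<theta> c = \<psi>" "\<forall>i<c. one_contiguous J K (\<theta> i) (\<theta> (Suc i))"
    using assms unfolding contiguous_def by blast
  then show "simplicial_map J K \<phi>"
    by (auto simp: one_contiguous_def)
  obtain c' where "c = Suc c'"
    using t(1) gr0_implies_Suc by blast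
  then show "simplicial_map J K \<psi>"
    using t by (auto simp: one_contiguous_def)
qed

lemma contiguous_mono:
  assumes c: "contiguous c J K \<phi> \<psi>" and "c \<le> d"
  shows "contiguous d J K \<phi> \<psi>"
proof -
  obtain \<theta> where t: "0 < c" "\<theta> 0 = \<phi>" "\<theta> c = \<psi>" "\<forall>i<c. one_contiguous J K (\<theta> i) (\<theta> (Suc i))"
    using c unfolding contiguous_def by blast
  have "one_contiguous J K (\<theta> (min c i)) (\<theta> (min c (Suc i)))" for i
    using t(3,4) one_contiguous_refl[OF contiguous_simplicial(2)[OF c]]
    by (cases "i < c") (simp_all add: min_absorb1 min_absorb2)
  then show ?thesis
    unfolding contiguous_def using t \<open>c \<le> d\<close>
    by (intro conjI exI[of _ "\<lambda>i. \<theta> (min c i)"]) auto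
qed

text \<open>Contiguity supplies, at each of the \<open>c\<close> steps, the common simplices for a straight-line
  homotopy. The map \<open>p\<close> allows the statement to be used on spaces that only map to \<open>\<parallel>J\<parallel>\<close>.\<close>

lemma contiguous_homotopic:
  assumes J: "finite_complex J" and K: "finite_complex K"
    and c: "contiguous c J K \<phi> \<psi>"
    and p: "continuous_map X (top_of_set (realization J)) p"
  shows "homotopic_with (\<lambda>_. True) X (top_of_set (realization K))
           (realization_map J \<phi> \<circ> p) (realization_map J \<psi> \<circ> p)"
proof -
  obtain \<theta> where t: "0 < c" "\<theta> 0 = \<phi>" "\<theta> c = \<psi>" "\<forall>i<c. one_contiguous J K (\<theta> i) (\<theta> (Suc i))"
    using c unfolding contiguous_def by blast
  have "homotopic_with (\<lambda>_. True) X (top_of_set (realization K))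
           (realization_map J \<phi> \<circ> p) (realization_map J (\<theta> i) \<circ> p)" if "i \<le> c" for i
    using that
  proof (induction i)
    case 0
    show ?case
      using t continuous_realization_map[OF J K contiguous_simplicial(1)[OF c] p]
      by (simp del: o_apply)
  next
    case (Suc i)
    have oc: "one_contiguous J K (\<theta> i) (\<theta> (Suc i))"
      using t Suc by simp
    then have s: "simplicial_map J K (\<theta> i)" "simplicial_map J K (\<theta> (Suc i))"
      by (auto simp: one_contiguous_def)
    have "homotopic_with (\<lambda>_. True) X (top_of_set (realization K))
           (realization_map J (\<theta> i) \<circ> p) (realization_map J (\<theta> (Suc i)) \<circ> p)"
    proof (rule homotopic_if_common_simplex[OF K])
      fix x assume "x \<in> topspace X"
      then have px: "p x \<in> realization J"
        using continuous_map_in[OF p] by blast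
      then have "support (p x) \<in> J"
        by (simp add: realization_iff[OF J])
      then have "\<theta> i ` support (p x) \<union> \<theta> (Suc i) ` support (p x) \<in> K"
        by (rule one_contiguousD[OF J K oc])
      then show "\<exists>\<sigma>\<in>K. support ((realization_map J (\<theta> i) \<circ> p) x) \<subseteq> \<sigma> \<and>
          support ((realization_map J (\<theta> (Suc i)) \<circ> p) x) \<subseteq> \<sigma>"
        by (auto simp: realization_map_support[OF J px])
    qed (use continuous_realization_map[OF J K _ p] s in auto)
    then show ?case
      using homotopic_with_trans Suc by fastforce
  qed
  then show ?thesis
    using t by blast
qed

section \<open>Approximations of the identity\<close>

text \<open>Vanishing outside \<open>\<sigma>\<close> is a closed condition.\<close>

lemma closed_simplex_support:
  assumes "x \<in> closed_simplex \<sigma>"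
  shows "support x \<subseteq> \<sigma>"
proof -
  have "closed {x. \<forall>v. v \<notin> \<sigma> \<longrightarrow> x v = (0::real)}"
    by (intro closed_Collect_all closed_Collect_imp open_Collect_const closed_Collect_eq
          continuous_on_const continuous_on_product_coordinates)
  then have "closed_simplex \<sigma> \<subseteq> {x. \<forall>v. v \<notin> \<sigma> \<longrightarrow> x v = 0}"
    unfolding closed_simplex_def by (intro closure_minimal) (auto simp: open_simplex_def)
  then show ?thesis
    using assms by (auto simp: support_def)
qed

text \<open>The form in which simplicial approximation is used: if \<open>x\<close> has a positive coordinate at \<open>v\<close>,
  then \<open>f x\<close> has a positive coordinate at \<open>\<psi> v\<close>, that is, \<open>f\<close> maps the open star of \<open>v\<close> into the
  open star of \<open>\<psi> v\<close>.\<close>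

lemma simplicial_approximation_support:
  assumes J: "finite_complex J" and K: "finite_complex K"
    and a: "simplicial_approximation J K f \<psi>" and x: "x \<in> realization J"
  shows "\<psi> ` support x \<subseteq> support (f x)"
proof -
  have "continuous_map (top_of_set (realization J)) (top_of_set (realization K)) f"
    using a by (simp add: simplicial_approximation_def)
  then have "f x \<in> realization K"
    using x continuous_map_in[of "top_of_set (realization J)" "realization K" f x] by simp
  then obtain \<sigma> where \<sigma>: "\<sigma> \<in> K" "f x \<in> open_simplex \<sigma>"
    by (auto simp: realization_def)
  then have "realization_map J \<psi> x \<in> closed_simplex \<sigma>"
    using a x by (auto simp: simplicial_approximation_def)
  then show ?thesis
    using closed_simplex_support realization_map_support[OF J x, of \<psi>] open_simplex_support[OF \<sigma>(2)]
    by metis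
qed

text \<open>Test the approximation at the vertex \<open>barycenter \<sigma>\<close>, which the identification sends to a point
  with support \<open>\<sigma>\<close>.\<close>

lemma approximation_of_identity_barycenter:
  assumes M: "finite_complex M"
    and a: "simplicial_approximation (Sd M) M (Sd_identification M) \<iota>" and \<sigma>: "\<sigma> \<in> M"
  shows "\<iota> (barycenter \<sigma>) \<in> \<sigma>"
proof -
  let ?x = "\<lambda>w. if w = barycenter \<sigma> then 1 else 0 :: real"
  have "{barycenter \<sigma>} \<in> Sd M"
    using \<sigma> by (auto simp: Sd_def chain_subset_def intro!: exI[of _ "{\<sigma>}"])
  moreover have "?x \<in> open_simplex {barycenter \<sigma>}"
    by (auto simp: open_simplex_def)
  ultimately have x: "?x \<in> realization (Sd M)"
    unfolding realization_def by blast
  have "\<iota> (barycenter \<sigma>) \<in> support (Sd_identification M ?x)"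
    using simplicial_approximation_support[OF finite_complex_Sd[OF M] M a x]
    by (simp add: support_def image_subset_iff)
  then have "(\<Sum>\<tau> | \<tau> \<in> M \<and> \<iota> (barycenter \<sigma>) \<in> \<tau>. ?x (barycenter \<tau>) / real (card \<tau>)) \<noteq> 0"
    by (simp add: support_def Sd_identification_def)
  then obtain \<tau> where \<tau>: "\<tau> \<in> M" "\<iota> (barycenter \<sigma>) \<in> \<tau>" "?x (barycenter \<tau>) / real (card \<tau>) \<noteq> 0"
    by (rule sum.not_neutral_contains_not_neutral) blast
  then have "barycenter \<tau> = barycenter \<sigma>"
    by (auto split: if_splits)
  then have "\<tau> = \<sigma>"
    using \<tau> \<sigma> finite_complexD(2)[OF M] by (simp add: barycenter_eq_iff)
  with \<tau> show ?thesis
    by simp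
qed

lemma approximations_of_identityD:
  assumes "approximations_of_identity L \<iota>"
  shows "simplicial_approximation (Sd (Sd_iter b L)) (Sd_iter b L)
    (Sd_identification (Sd_iter b L)) (\<iota> (Suc b))"
  using assms unfolding approximations_of_identity_def
  by (metis Sd_iter.simps(2) diff_Suc_1 le_add1 plus_1_eq_Suc)

lemma simplicial_map_pullback:
  assumes L: "finite_complex L" and \<iota>: "approximations_of_identity L \<iota>"
    and \<phi>: "simplicial_map L K \<phi>"
  shows "simplicial_map (Sd_iter b L) K (pullback \<iota> \<phi> b)"
proof (induction b)
  case 0
  show ?case
    using \<phi> by (auto simp: simplicial_map_def image_image)
next
  case (Suc b)
  have "simplicial_map (Sd (Sd_iter b L)) (Sd_iter b L) (\<iota> (Suc b))"
    using approximations_of_identityD[OF \<iota>] by (simp add: simplicial_approximation_def)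
  then show ?case
    using Suc by (simp add: simplicial_map_def flip: image_image)
qed

section \<open>Peak coordinates\<close>

text \<open>For nonempty \<open>\<sigma> \<subseteq> V\<close> and nonnegative \<open>x\<close>, \<open>peak V \<sigma> x\<close> is positive exactly if \<open>\<sigma>\<close> is a strict
  superlevel set of the coordinate function \<open>x\<close> at a positive level. This is also when the
  subdivision coordinate of \<open>x\<close> at the barycentre of \<open>\<sigma>\<close> is positive. That coordinate is
  \<open>card \<sigma>\<close> times the positive part of \<open>Min\<^bsub>\<sigma>\<^esub> x - Max\<^bsub>V - \<sigma>\<^esub> x\<close> (the maximum over the empty set being \<open>0\<close>); the product below has the same
  sign and is visibly continuous, and only the sign matters for the homotopies.\<close>

definition peak :: "'v set \<Rightarrow> 'v set \<Rightarrow> ('v \<Rightarrow> real) \<Rightarrow> real" where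
  "peak V \<sigma> x = (\<Prod>v\<in>\<sigma>. x v * (\<Prod>w\<in>V - \<sigma>. max 0 (x v - x w)))"

definition peaks :: "'v set set \<Rightarrow> 'v set set \<Rightarrow> ('v \<Rightarrow> real) \<Rightarrow> real" where
  "peaks M J x = (\<Sum>\<sigma>\<in>J. peak (\<Union>M) \<sigma> x)"

text \<open>Normalised peak coordinates as weights: the simplex \<open>\<sigma>\<close> puts its weight on the vertex \<open>q \<sigma>\<close>.
  With \<open>q = barycenter\<close> and \<open>J = M\<close> the result is a map \<open>\<parallel>M\<parallel> \<rightarrow> \<parallel>Sd M\<parallel>\<close>. With \<open>q \<sigma> \<in> \<sigma>\<close> for a
  subcomplex \<open>J\<close> it is a map to \<open>\<parallel>J\<parallel>\<close> from the open set where \<open>peaks M J\<close> is positive.\<close>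

definition peak_map ::
  "'v set set \<Rightarrow> 'v set set \<Rightarrow> ('v set \<Rightarrow> 'w) \<Rightarrow> ('v \<Rightarrow> real) \<Rightarrow> ('w \<Rightarrow> real)" where
  "peak_map M J q x =
     (\<lambda>w. (\<Sum>\<sigma> | \<sigma> \<in> J \<and> q \<sigma> = w. peak (\<Union>M) \<sigma> x) / peaks M J x)"

definition peak_chain :: "'v set set \<Rightarrow> 'v set set \<Rightarrow> ('v \<Rightarrow> real) \<Rightarrow> 'v set set" where
  "peak_chain M J x = {\<sigma>\<in>J. 0 < peak (\<Union>M) \<sigma> x}"

lemma peak_nonneg:
  assumes "\<And>v. 0 \<le> x v"
  shows "0 \<le> peak V \<sigma> x"
  unfolding peak_def using assms by (intro prod_nonneg mult_nonneg_nonneg ballI) auto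

lemma peak_pos_iff:
  assumes "finite V" "\<sigma> \<subseteq> V" "\<And>v. 0 \<le> x v"
  shows "0 < peak V \<sigma> x \<longleftrightarrow> (\<forall>v\<in>\<sigma>. 0 < x v \<and> (\<forall>w\<in>V - \<sigma>. x w < x v))"
proof -
  have fin: "finite \<sigma>" "finite (V - \<sigma>)"
    using assms finite_subset by auto
  have "0 < peak V \<sigma> x \<longleftrightarrow> peak V \<sigma> x \<noteq> 0"
    using peak_nonneg[of x V \<sigma>, OF assms(3)] by linarith
  also have "\<dots> \<longleftrightarrow> (\<forall>v\<in>\<sigma>. x v \<noteq> 0 \<and> (\<forall>w\<in>V - \<sigma>. max 0 (x v - x w) \<noteq> 0))"
    unfolding peak_def using fin by (auto simp: prod_zero_iff)
  also have "\<dots> \<longleftrightarrow> (\<forall>v\<in>\<sigma>. 0 < x v \<and> (\<forall>w\<in>V - \<sigma>. x w < x v))"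
  proof -
    have "max 0 (x v - x w) \<noteq> 0 \<longleftrightarrow> x w < x v" for v w
      by auto
    moreover have "x v \<noteq> 0 \<longleftrightarrow> 0 < x v" for v
      using assms(3)[of v] by auto
    ultimately show ?thesis
      by simp
  qed
  finally show ?thesis .
qed

text \<open>Two superlevel sets of the same function are always nested.\<close>

lemma peak_chain_chain:
  assumes M: "finite_complex M" and x: "x \<in> realization M" and J: "J \<subseteq> M"
  shows "peak_chain M J x \<subseteq> J" "chain\<^sub>\<subseteq> (peak_chain M J x)"
    and "\<And>\<sigma>. \<sigma> \<in> peak_chain M J x \<Longrightarrow> \<sigma> \<subseteq> support x"
proof -
  have pos: "(\<forall>v\<in>\<sigma>. 0 < x v \<and> (\<forall>w\<in>\<Union>M - \<sigma>. x w < x v))" "\<sigma> \<subseteq> \<Union>M"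
    if "\<sigma> \<in> peak_chain M J x" for \<sigma>
    using that peak_pos_iff[OF finite_vertices[OF M], of \<sigma> x] J x
    by (auto simp: peak_chain_def realization_iff[OF M])
  show "peak_chain M J x \<subseteq> J"
    by (auto simp: peak_chain_def)
  show "\<sigma> \<subseteq> support x" if "\<sigma> \<in> peak_chain M J x" for \<sigma>
    using pos[OF that] by (force simp: support_def)
  show "chain\<^sub>\<subseteq> (peak_chain M J x)"
    unfolding chain_subset_def
  proof (intro ballI, rule ccontr)
    fix \<sigma> \<tau> assume *: "\<sigma> \<in> peak_chain M J x" "\<tau> \<in> peak_chain M J x" "\<not> (\<sigma> \<subseteq> \<tau> \<or> \<tau> \<subseteq> \<sigma>)"
    then obtain v w where "v \<in> \<sigma>" "v \<notin> \<tau>" "w \<in> \<tau>" "w \<notin> \<sigma>"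
      by blast
    then have "x w < x v" "x v < x w"
      using pos[OF *(1)] pos[OF *(2)] by blast+
    then show False
      by simp
  qed
qed

lemma peaks_pos_iff:
  assumes M: "finite_complex M" and x: "x \<in> realization M" and J: "J \<subseteq> M"
  shows "0 < peaks M J x \<longleftrightarrow> peak_chain M J x \<noteq> {}"
proof -
  have "finite J"
    using J finite_complexD(1)[OF M] finite_subset by blast
  moreover have nn: "0 \<le> peak (\<Union>M) \<sigma> x" for \<sigma>
    using x by (intro peak_nonneg) (simp add: realization_iff[OF M])
  ultimately have "peaks M J x = 0 \<longleftrightarrow> (\<forall>\<sigma>\<in>J. peak (\<Union>M) \<sigma> x = 0)"
    unfolding peaks_def by (intro sum_nonneg_eq_0_iff)
  moreover have "0 \<le> peaks M J x"
    unfolding peaks_def using nn by (intro sum_nonneg)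
  ultimately show ?thesis
    using nn by (auto simp: peak_chain_def less_le)
qed

text \<open>The vertices at which \<open>x\<close> takes its maximum form a strict superlevel set.\<close>

lemma ex_peak_pos:
  assumes M: "finite_complex M" and x: "x \<in> realization M"
  shows "\<exists>\<sigma>\<in>M. 0 < peak (\<Union>M) \<sigma> x"
proof -
  have s: "support x \<in> M" and nn: "\<And>v. 0 \<le> x v"
    using x by (auto simp: realization_iff[OF M])
  have fin: "finite (support x)" "support x \<noteq> {}"
    using finite_complexD(2)[OF M s] by auto
  define m where "m = Max (x ` support x)"
  define \<sigma> where "\<sigma> = {v. x v = m}"
  have "m \<in> x ` support x"
    unfolding m_def using fin by (intro Max_in) auto
  then have m: "0 < m" and ne: "\<sigma> \<noteq> {}"
    using nn by (auto simp: support_def \<sigma>_def less_le)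
  have le: "x v \<le> m" for v
  proof (cases "v \<in> support x")
    case True
    then show ?thesis
      unfolding m_def using fin by simp
  next
    case False
    then show ?thesis
      using m by (simp add: support_def)
  qed
  have "\<sigma> \<subseteq> support x"
    using m by (auto simp: \<sigma>_def support_def)
  then have \<sigma>: "\<sigma> \<in> M"
    using finite_complexD(3)[OF M s] ne by blast
  have "x w < x v" if "v \<in> \<sigma>" "w \<notin> \<sigma>" for v w
    using that le[of w] by (auto simp: \<sigma>_def)
  moreover have "0 < x v" if "v \<in> \<sigma>" for v
    using that m by (simp add: \<sigma>_def)
  ultimately have "0 < peak (\<Union>M) \<sigma> x"
    using \<sigma> nn by (subst peak_pos_iff[OF finite_vertices[OF M]]) auto
  with \<sigma> show ?thesis
    by blast
qed

lemma continuous_peak: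
  assumes "finite_complex M" "\<sigma> \<in> M"
    and "continuous_map X (top_of_set (realization K)) f"
  shows "continuous_map X euclideanreal (\<lambda>x. peak (\<Union>M) \<sigma> (f x))"
  unfolding peak_def
  using assms finite_vertices[OF assms(1)] finite_complexD(2)[OF assms(1,2)]
  by (intro continuous_map_prod continuous_map_real_mult continuous_map_real_max
        continuous_map_diff continuous_map_coordinate[OF assms(3)]) auto

lemma continuous_peaks:
  assumes "finite_complex M" "J \<subseteq> M"
    and "continuous_map X (top_of_set (realization K)) f"
  shows "continuous_map X euclideanreal (\<lambda>x. peaks M J (f x))"
  unfolding peaks_def using assms finite_complexD(1)[OF assms(1)] finite_subset
  by (intro continuous_map_sum continuous_peak[OF assms(1)]) blast+

lemma peak_map_support:
  assumes M: "finite_complex M" and x: "x \<in> realization M" and J: "J \<subseteq> M"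
    and pos: "0 < peaks M J x"
  shows "support (peak_map M J q x) = q ` peak_chain M J x"
proof -
  have fin: "finite J"
    using J finite_complexD(1)[OF M] finite_subset by blast
  have nn: "0 \<le> peak (\<Union>M) \<sigma> x" for \<sigma>
    using x by (intro peak_nonneg) (simp add: realization_iff[OF M])
  have "peak_map M J q x w = 0 \<longleftrightarrow> w \<notin> q ` peak_chain M J x" for w
    unfolding peak_map_def peak_chain_def using pos fin nn
    by (auto simp: sum_nonneg_eq_0_iff less_le)
  then show ?thesis
    by (auto simp: support_def)
qed

text \<open>The image of \<open>x\<close> is supported on \<open>q ` C\<close> for a nonempty chain \<open>C\<close> of simplices of \<open>J\<close>;
  these sets therefore have to be simplices of the target complex.\<close>

lemma continuous_peak_map:
  assumes M: "finite_complex M" and J: "J \<subseteq> M" and N: "finite_complex N"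
    and f: "continuous_map X (top_of_set (realization M)) f"
    and pos: "\<And>x. x \<in> topspace X \<Longrightarrow> 0 < peaks M J (f x)"
    and q: "\<And>C. C \<subseteq> J \<Longrightarrow> C \<noteq> {} \<Longrightarrow> chain\<^sub>\<subseteq> C \<Longrightarrow> q ` C \<in> N"
  shows "continuous_map X (top_of_set (realization N)) (peak_map M J q \<circ> f)"
proof (rule continuous_map_realization)
  have fin: "finite J"
    using J finite_complexD(1)[OF M] finite_subset by blast
  show "continuous_map X euclideanreal (\<lambda>x. (peak_map M J q \<circ> f) x w)" for w
    unfolding peak_map_def o_def using fin pos J
    by (intro continuous_map_real_divide continuous_map_sum continuous_peak[OF M _ f]
          continuous_peaks[OF M J f]) force+
  fix x assume "x \<in> topspace X"
  then have y: "f x \<in> realization M" and p: "0 < peaks M J (f x)"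
    using continuous_map_in[OF f] pos by auto
  have "peak_chain M J (f x) \<noteq> {}"
    using p peaks_pos_iff[OF M y J] by simp
  then have "q ` peak_chain M J (f x) \<in> N"
    using peak_chain_chain[OF M y J] by (intro q)
  then have s: "support (peak_map M J q (f x)) \<in> N"
    by (simp add: peak_map_support[OF M y J p])
  have nn: "0 \<le> peak (\<Union>M) \<sigma> (f x)" for \<sigma>
    using y by (intro peak_nonneg) (simp add: realization_iff[OF M])
  have sub: "q ` J \<subseteq> \<Union>N"
  proof (intro image_subsetI)
    fix \<sigma> assume "\<sigma> \<in> J"
    then have "q ` {\<sigma>} \<in> N"
      by (intro q) (auto simp: chain_subset_def)
    then show "q \<sigma> \<in> \<Union>N"
      by auto
  qed
  have "(\<Sum>w\<in>\<Union>N. peak_map M J q (f x) w) = (\<Sum>\<sigma>\<in>J. peak (\<Union>M) \<sigma> (f x)) / peaks M J (f x)"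
    unfolding peak_map_def sum_divide_distrib[symmetric]
    using sum.group[OF fin finite_vertices[OF N] sub, of "\<lambda>\<sigma>. peak (\<Union>M) \<sigma> (f x)"] by simp
  then have "(\<Sum>w\<in>\<Union>N. peak_map M J q (f x) w) = 1"
    using p by (simp add: peaks_def)
  moreover have "0 \<le> peak_map M J q (f x) w" for w
    unfolding peak_map_def using nn p by (intro divide_nonneg_pos sum_nonneg) auto
  ultimately show "(peak_map M J q \<circ> f) x \<in> realization N"
    using s by (simp add: realization_iff[OF N])
qed

section \<open>From covers by subcomplexes to open covers\<close>

lemma simplicial_map_Sd_iter_Vertex: "simplicial_map L (Sd_iter 0 L) Vertex"
  by (auto simp: simplicial_map_def)

text \<open>The map \<open>s\<close> stands in for the inverse of the identification \<open>\<parallel>Sd\<^sup>b L\<parallel> \<cong> \<parallel>L\<parallel>\<close>. In each step the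
  peak map, followed by \<open>\<parallel>\<iota>\<parallel>\<close>, moves no point out of its simplex, since \<open>\<iota>\<close> sends the barycentre of
  \<open>\<sigma>\<close> to a vertex of \<open>\<sigma>\<close>. Hence the composites with the pullbacks of \<open>\<phi>\<close> before and after the step
  are homotopic.\<close>

lemma ex_subdivision_map:
  assumes L: "finite_complex L" and K: "finite_complex K" and \<iota>: "approximations_of_identity L \<iota>"
  shows "\<exists>s. continuous_map (top_of_set (realization L)) (top_of_set (realization (Sd_iter b L))) s \<and>
    (\<forall>\<phi>. simplicial_map L K \<phi> \<longrightarrow>
      homotopic_with (\<lambda>_. True) (top_of_set (realization L)) (top_of_set (realization K))
        (realization_map L \<phi>) (realization_map (Sd_iter b L) (pullback \<iota> \<phi> b) \<circ> s))"
proof (induction b)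
  case 0
  note L0 = finite_complex_Sd_iter[OF L, of 0]
  let ?s = "realization_map L Vertex"
  have s: "continuous_map (top_of_set (realization L)) (top_of_set (realization (Sd_iter 0 L))) ?s"
    using continuous_realization_map[OF L L0 simplicial_map_Sd_iter_Vertex
        continuous_map_id] by simp
  have "homotopic_with (\<lambda>_. True) (top_of_set (realization L)) (top_of_set (realization K))
        (realization_map L \<phi>) (realization_map (Sd_iter 0 L) (pullback \<iota> \<phi> 0) \<circ> ?s)"
    if \<phi>: "simplicial_map L K \<phi>" for \<phi>
  proof (rule homotopic_if_common_simplex[OF K])
    show "continuous_map (top_of_set (realization L)) (top_of_set (realization K)) (realization_map L \<phi>)"
      using continuous_realization_map[OF L K \<phi> continuous_map_id] by simp
    show "continuous_map (top_of_set (realization L)) (top_of_set (realization K))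
        (realization_map (Sd_iter 0 L) (pullback \<iota> \<phi> 0) \<circ> ?s)"
      by (rule continuous_realization_map[OF L0 K simplicial_map_pullback[OF L \<iota> \<phi>] s])
    fix x assume "x \<in> topspace (top_of_set (realization L))"
    then have x: "x \<in> realization L" and y: "?s x \<in> realization (Sd_iter 0 L)"
      using continuous_map_in[OF s] by auto
    have "\<phi> ` support x \<in> K"
      using x \<phi> by (auto simp: realization_iff[OF L] simplicial_map_def)
    then show "\<exists>\<sigma>\<in>K. support (realization_map L \<phi> x) \<subseteq> \<sigma> \<and>
        support ((realization_map (Sd_iter 0 L) (pullback \<iota> \<phi> 0) \<circ> ?s) x) \<subseteq> \<sigma>"
      by (intro bexI[of _ "\<phi> ` support x"])
        (simp_all del: Sd_iter.simps add: realization_map_support[OF L x]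
          realization_map_support[OF L0 y] image_image)
  qed
  with s show ?case
    by blast
next
  case (Suc b)
  let ?M = "Sd_iter b L" and ?X = "top_of_set (realization L)" and ?Y = "top_of_set (realization K)"
  note M = finite_complex_Sd_iter[OF L, of b] and SM = finite_complex_Sd_iter[OF L, of "Suc b"]
  obtain s where s: "continuous_map ?X (top_of_set (realization ?M)) s"
    and hom: "\<And>\<phi>. simplicial_map L K \<phi> \<Longrightarrow> homotopic_with (\<lambda>_. True) ?X ?Y
        (realization_map L \<phi>) (realization_map ?M (pullback \<iota> \<phi> b) \<circ> s)"
    using Suc by blast
  let ?s = "peak_map ?M ?M barycenter \<circ> s"
  have pos: "0 < peaks ?M ?M y" if "y \<in> realization ?M" for y
    using ex_peak_pos[OF M that] peaks_pos_iff[OF M that] by (auto simp: peak_chain_def)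
  have s': "continuous_map ?X (top_of_set (realization (Sd_iter (Suc b) L))) ?s"
  proof (rule continuous_peak_map[OF M subset_refl SM s])
    show "0 < peaks ?M ?M (s x)" if "x \<in> topspace ?X" for x
      using pos continuous_map_in[OF s that] by blast
  qed (auto simp: Sd_def)
  have "homotopic_with (\<lambda>_. True) ?X ?Y
      (realization_map L \<phi>) (realization_map (Sd_iter (Suc b) L) (pullback \<iota> \<phi> (Suc b)) \<circ> ?s)"
    if \<phi>: "simplicial_map L K \<phi>" for \<phi>
  proof (rule homotopic_with_trans[OF hom[OF \<phi>]], rule homotopic_if_common_simplex[OF K])
    note sp = simplicial_map_pullback[OF L \<iota> \<phi>]
    show "continuous_map ?X ?Y (realization_map ?M (pullback \<iota> \<phi> b) \<circ> s)"
      by (rule continuous_realization_map[OF M K sp s])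
    show "continuous_map ?X ?Y (realization_map (Sd_iter (Suc b) L) (pullback \<iota> \<phi> (Suc b)) \<circ> ?s)"
      by (rule continuous_realization_map[OF SM K sp s'])
    fix x assume x: "x \<in> topspace ?X"
    have y: "s x \<in> realization ?M" and z: "?s x \<in> realization (Sd_iter (Suc b) L)"
      using continuous_map_in[OF s x] continuous_map_in[OF s' x] by auto
    let ?C = "peak_chain ?M ?M (s x)"
    have "\<iota> (Suc b) ` barycenter ` ?C \<subseteq> support (s x)"
      using approximation_of_identity_barycenter[OF M approximations_of_identityD[OF \<iota>]]
        peak_chain_chain(1,3)[OF M y subset_refl] by blast
    then have "pullback \<iota> \<phi> (Suc b) ` support (?s x) \<subseteq> pullback \<iota> \<phi> b ` support (s x)"
      using peak_map_support[OF M y subset_refl pos[OF y], of barycenter]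
      by (auto simp: subset_iff)
    moreover have "pullback \<iota> \<phi> b ` support (s x) \<in> K"
      using sp[of b] y by (auto simp: simplicial_map_def realization_iff[OF M])
    ultimately show "\<exists>\<sigma>\<in>K. support ((realization_map ?M (pullback \<iota> \<phi> b) \<circ> s) x) \<subseteq> \<sigma> \<and>
        support ((realization_map (Sd_iter (Suc b) L) (pullback \<iota> \<phi> (Suc b)) \<circ> ?s) x) \<subseteq> \<sigma>"
      using realization_map_support[OF M y, of "pullback \<iota> \<phi> b"]
        realization_map_support[OF SM z, of "pullback \<iota> \<phi> (Suc b)"]
      by (intro bexI[of _ "pullback \<iota> \<phi> b ` support (s x)"]) (simp_all del: pullback.simps)
  qed
  with s' show ?case
    by blast
qed

text \<open>Where \<open>peaks M J\<close> is positive, the peak map pushes points into \<open>\<parallel>J\<parallel>\<close> without leaving their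
  simplices of \<open>M\<close>. So both maps factor through \<open>\<parallel>J\<parallel>\<close> up to homotopy, and there contiguity applies.
  This replaces the closed set \<open>\<parallel>J\<parallel>\<close> by an open one.\<close>

lemma contiguous_homotopic_near_subcomplex:
  assumes M: "finite_complex M" and K: "finite_complex K" and J: "subcomplex J M"
    and \<phi>: "simplicial_map M K \<phi>" and \<psi>: "simplicial_map M K \<psi>"
    and c: "contiguous c J K \<phi> \<psi>"
    and s: "continuous_map X (top_of_set (realization M)) s"
    and pos: "\<And>x. x \<in> topspace X \<Longrightarrow> 0 < peaks M J (s x)"
  shows "homotopic_with (\<lambda>_. True) X (top_of_set (realization K))
    (realization_map M \<phi> \<circ> s) (realization_map M \<psi> \<circ> s)"
proof -
  have JM: "J \<subseteq> M" and fJ: "finite_complex J"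
    using J by (auto simp: subcomplex_def)
  define q where "q \<sigma> = (SOME v. v \<in> \<sigma>)" for \<sigma> :: "'a set"
  have q: "q \<sigma> \<in> \<sigma>" if "\<sigma> \<in> J" for \<sigma>
    using finite_complexD(2)[OF fJ that] by (simp add: q_def some_in_eq)
  have qC: "q ` C \<in> J" if C: "C \<subseteq> J" "C \<noteq> {}" "chain\<^sub>\<subseteq> C" for C
  proof -
    have "finite C"
      using C finite_complexD(1)[OF fJ] finite_subset by blast
    then have "\<Union>C \<in> C"
      using C Union_in_chain[of C C] by (auto simp: subset_chain_def chain_subset_def)
    then have "\<Union>C \<in> J"
      using C by blast
    moreover have "q ` C \<subseteq> \<Union>C"
      using q C by blast
    ultimately show ?thesis
      using finite_complexD(3)[OF fJ] C by blast
  qed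
  let ?r = "peak_map M J q \<circ> s"
  have r: "continuous_map X (top_of_set (realization J)) ?r"
    by (rule continuous_peak_map[OF M JM fJ s pos qC])
  have *: "homotopic_with (\<lambda>_. True) X (top_of_set (realization K))
      (realization_map M \<theta> \<circ> s) (realization_map J \<theta> \<circ> ?r)" if \<theta>: "simplicial_map M K \<theta>" for \<theta>
  proof (rule homotopic_if_common_simplex[OF K])
    show "continuous_map X (top_of_set (realization K)) (realization_map M \<theta> \<circ> s)"
      by (rule continuous_realization_map[OF M K \<theta> s])
    have "simplicial_map J K \<theta>"
      using \<theta> JM by (auto simp: simplicial_map_def)
    then show "continuous_map X (top_of_set (realization K)) (realization_map J \<theta> \<circ> ?r)"
      by (rule continuous_realization_map[OF fJ K _ r])
    fix x assume x: "x \<in> topspace X"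
    have y: "s x \<in> realization M" and z: "?r x \<in> realization J"
      using continuous_map_in[OF s x] continuous_map_in[OF r x] by auto
    have "support (?r x) \<subseteq> support (s x)"
      using peak_map_support[OF M y JM pos[OF x], of q] peak_chain_chain(1,3)[OF M y JM] q
      by fastforce
    moreover have "\<theta> ` support (s x) \<in> K"
      using y \<theta> by (auto simp: simplicial_map_def realization_iff[OF M])
    ultimately show "\<exists>\<sigma>\<in>K. support ((realization_map M \<theta> \<circ> s) x) \<subseteq> \<sigma> \<and>
        support ((realization_map J \<theta> \<circ> ?r) x) \<subseteq> \<sigma>"
      using realization_map_support[OF M y, of \<theta>] realization_map_support[OF fJ z, of \<theta>]
      by (intro bexI[of _ "\<theta> ` support (s x)"]) (simp_all add: image_mono)
  qed
  show ?thesis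
    using *[OF \<phi>] contiguous_homotopic[OF fJ K c r] *[OF \<psi>]
    by (meson homotopic_with_sym homotopic_with_trans)
qed

text \<open>The open sets are the preimages under \<open>s\<close> of the neighbourhoods \<open>peaks M J > 0\<close>. They cover
  because every point has a positive peak at some simplex, and that simplex lies in some member of
  the given cover.\<close>

lemma open_cover_of_subcomplex_cover:
  assumes L: "finite_complex L" and K: "finite_complex K" and \<iota>: "approximations_of_identity L \<iota>"
    and \<phi>: "simplicial_map L K \<phi>" and \<psi>: "simplicial_map L K \<psi>"
    and fin: "finite \<J>" and cov: "\<Union>\<J> = Sd_iter b L"
    and J: "\<And>J. J \<in> \<J> \<Longrightarrow> subcomplex J (Sd_iter b L) \<and>
              contiguous c J K (pullback \<iota> \<phi> b) (pullback \<iota> \<psi> b)"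
  shows "\<exists>\<U>. finite \<U> \<and> card \<U> \<le> card \<J> \<and> \<Union>\<U> = realization L \<and>
    (\<forall>U\<in>\<U>. openin (top_of_set (realization L)) U \<and>
      homotopic_with (\<lambda>_. True) (subtopology (top_of_set (realization L)) U)
        (top_of_set (realization K)) (realization_map L \<phi>) (realization_map L \<psi>))"
proof -
  let ?M = "Sd_iter b L" and ?X = "top_of_set (realization L)" and ?Y = "top_of_set (realization K)"
  note M = finite_complex_Sd_iter[OF L, of b]
  obtain s where s: "continuous_map ?X (top_of_set (realization ?M)) s"
    and hom: "\<And>\<phi>. simplicial_map L K \<phi> \<Longrightarrow> homotopic_with (\<lambda>_. True) ?X ?Y
        (realization_map L \<phi>) (realization_map ?M (pullback \<iota> \<phi> b) \<circ> s)"
    using ex_subdivision_map[OF L K \<iota>, of b] by blast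
  define U where "U J = {x \<in> topspace ?X. peaks ?M J (s x) \<in> {0<..}}" for J
  have "openin ?X (U J)" if "J \<in> \<J>" for J
    unfolding U_def using J[OF that]
    by (intro openin_continuous_map_preimage[where Y = euclideanreal] continuous_peaks[OF M _ s])
      (auto simp: subcomplex_def)
  moreover have "homotopic_with (\<lambda>_. True) (subtopology ?X (U J)) ?Y
      (realization_map L \<phi>) (realization_map L \<psi>)" if "J \<in> \<J>" for J
  proof -
    have "homotopic_with (\<lambda>_. True) (subtopology ?X (U J)) ?Y
        (realization_map ?M (pullback \<iota> \<phi> b) \<circ> s) (realization_map ?M (pullback \<iota> \<psi> b) \<circ> s)"
    proof (rule contiguous_homotopic_near_subcomplex[OF M K])
      show "continuous_map (subtopology ?X (U J)) (top_of_set (realization ?M)) s"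
        by (rule continuous_map_from_subtopology[OF s])
    qed (use J[OF that] simplicial_map_pullback[OF L \<iota>] \<phi> \<psi> in \<open>auto simp: U_def\<close>)
    then show ?thesis
      using hom[OF \<phi>, THEN homotopic_from_subtopology, of "U J"]
        hom[OF \<psi>, THEN homotopic_from_subtopology, of "U J"]
      by (meson homotopic_with_sym homotopic_with_trans)
  qed
  moreover have "\<Union>(U ` \<J>) = realization L"
  proof (intro equalityI subsetI)
    fix x assume x: "x \<in> realization L"
    then have y: "s x \<in> realization ?M"
      using continuous_map_in[OF s] by auto
    obtain \<sigma> where \<sigma>: "\<sigma> \<in> ?M" "0 < peak (\<Union>?M) \<sigma> (s x)"
      using ex_peak_pos[OF M y] by blast
    then obtain J' where J': "J' \<in> \<J>" "\<sigma> \<in> J'"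
      using cov by blast
    then have "\<sigma> \<in> peak_chain ?M J' (s x)"
      using \<sigma> by (simp add: peak_chain_def)
    then have "0 < peaks ?M J' (s x)"
      using peaks_pos_iff[OF M y] J[OF J'(1)] by (auto simp: subcomplex_def)
    then show "x \<in> \<Union>(U ` \<J>)"
      using J' x by (auto simp: U_def)
  qed (auto simp: U_def)
  ultimately show ?thesis
    using fin card_image_le[OF fin, of U] by (intro exI[of _ "U ` \<J>"]) auto
qed

section \<open>Compactness of realizations\<close>

text \<open>The realization is a finite union of closed subsets of a product of intervals and points, which
  is compact by Tychonoff's theorem.\<close>

lemma compact_realization:
  assumes K: "finite_complex K"
  shows "compact (realization K)"
proof -
  define V where "V = \<Union>K"
  have fin: "finite V"
    unfolding V_def by (rule finite_vertices[OF K])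
  let ?B = "PiE UNIV (\<lambda>v. if v \<in> V then {0..1::real} else {0})"
  have "compactin (product_topology (\<lambda>_::'a. euclideanreal) UNIV) ?B"
    by (subst compactin_PiE) auto
  then have B: "compact ?B"
    by (simp add: euclidean_product_topology)
  define S where "S \<sigma> = {x. (\<forall>v. 0 \<le> x v) \<and> (\<forall>v. v \<notin> \<sigma> \<longrightarrow> x v = 0) \<and> (\<Sum>v\<in>V. x v) = (1::real)}"
    for \<sigma> :: "'a set"
  have "closed (S \<sigma>)" for \<sigma>
    unfolding S_def
    by (intro closed_Collect_conj closed_Collect_all closed_Collect_imp open_Collect_const
          closed_Collect_le closed_Collect_eq continuous_on_sum continuous_on_const
          continuous_on_product_coordinates)
  moreover have "realization K = (\<Union>\<sigma>\<in>K. S \<sigma>)"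
  proof (intro equalityI subsetI)
    fix x assume "x \<in> realization K"
    then have "support x \<in> K" "x \<in> S (support x)"
      by (auto simp: realization_iff[OF K] S_def V_def support_def)
    then show "x \<in> (\<Union>\<sigma>\<in>K. S \<sigma>)"
      by blast
  next
    fix x assume "x \<in> (\<Union>\<sigma>\<in>K. S \<sigma>)"
    then obtain \<sigma> where "\<sigma> \<in> K" "x \<in> S \<sigma>"
      by blast
    then show "x \<in> realization K"
      by (intro realizationI[OF K \<open>\<sigma> \<in> K\<close>]) (auto simp: S_def V_def support_def)
  qed
  ultimately have "closed (realization K)"
    using finite_complexD(1)[OF K] by (simp add: closed_UN)
  moreover have "realization K \<subseteq> ?B"
  proof
    fix x assume x: "x \<in> realization K"
    have "x v \<le> 1" if "v \<in> V" for v
      using x member_le_sum[OF that, of x] fin by (auto simp: realization_iff[OF K] V_def)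
    moreover have "x v = 0" if "v \<notin> V" for v
      using x that by (auto simp: realization_iff[OF K] V_def support_def)
    ultimately show "x \<in> ?B"
      using x by (auto simp: realization_iff[OF K])
  qed
  ultimately show ?thesis
    using compact_Int_closed[OF B] by (metis inf.absorb2)
qed

text \<open>A Lebesgue number for compact spaces on which finitely many real functions separate the points.
  For an uncountable vertex type the product topology on \<open>'a \<Rightarrow> real\<close> is not metrizable, but the
  coordinates at the finitely many vertices separate the points of the realization, and so the
  \<open>\<ell>\<^sup>1\<close> distance \<open>d\<close> in these coordinates is as good as a metric.\<close>

lemma Lebesgue_number_coordinates:
  fixes S :: "'x::topological_space set" and e :: "'i \<Rightarrow> 'x \<Rightarrow> real"
  assumes S: "compact S" and I: "finite I" and e: "\<And>i. i \<in> I \<Longrightarrow> continuous_on S (e i)"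
    and sep: "\<And>x y. \<lbrakk>x \<in> S; y \<in> S; \<forall>i\<in>I. e i x = e i y\<rbrakk> \<Longrightarrow> x = y"
    and cover: "S \<subseteq> \<Union>\<C>" and op: "\<And>C. C \<in> \<C> \<Longrightarrow> openin (top_of_set S) C"
  shows "\<exists>\<delta>>0. \<forall>x\<in>S. \<exists>C\<in>\<C>. \<forall>y\<in>S. (\<forall>i\<in>I. \<bar>e i x - e i y\<bar> < \<delta>) \<longrightarrow> y \<in> C"
proof -
  define d where "d x y = (\<Sum>i\<in>I. \<bar>e i x - e i y\<bar>)" for x y
  have d_cont: "continuous_on S (d x)" for x
    unfolding d_def by (intro continuous_intros e)
  have d_tri: "d x z \<le> d x y + d y z" for x y z
    unfolding d_def sum.distrib[symmetric] by (intro sum_mono) linarith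
  have d_comm: "d x y = d y x" for x y
    unfolding d_def by (simp add: abs_minus_commute)
  have "\<exists>\<epsilon> C. \<epsilon> > 0 \<and> C \<in> \<C> \<and> (\<forall>y\<in>S. d x y < \<epsilon> \<longrightarrow> y \<in> C)" if x: "x \<in> S" for x
  proof -
    obtain C where C: "C \<in> \<C>" "x \<in> C"
      using cover x by blast
    obtain T where T: "open T" "C = S \<inter> T"
      using op[OF C(1)] by (auto simp: openin_open)
    show ?thesis
    \<comment> \<open>The distance from \<open>x\<close> to the complement of \<open>C\<close> is attained, hence positive.\<close>
    proof (cases "S - C = {}")
      case True
      then show ?thesis
        using C by (intro exI[of _ 1] exI[of _ C]) auto
    next
      case False
      have "S - C = S \<inter> - T"
        using T by blast
      then have "compact (S - C)"
        using S T(1) by (simp add: compact_Int_closed closed_Compl)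
      moreover have "continuous_on (S - C) (d x)"
        by (rule continuous_on_subset[OF d_cont]) auto
      ultimately obtain z where z: "z \<in> S - C" "\<And>y. y \<in> S - C \<Longrightarrow> d x z \<le> d x y"
        using False continuous_attains_inf[of "S - C" "d x"] by blast
      have "0 \<le> d x z"
        unfolding d_def by (intro sum_nonneg) auto
      moreover have "d x z \<noteq> 0"
      proof
        assume "d x z = 0"
        then have "\<forall>i\<in>I. e i x = e i z"
          unfolding d_def using I by (subst (asm) sum_nonneg_eq_0_iff) auto
        with sep x z C show False
          by blast
      qed
      ultimately show ?thesis
        using z(2) C(1) by (intro exI[of _ "d x z"] exI[of _ C]) (auto simp: not_less[symmetric])
    qed
  qed
  then obtain \<epsilon> C where \<epsilon>: "\<And>x. x \<in> S \<Longrightarrow> \<epsilon> x > 0" and C: "\<And>x. x \<in> S \<Longrightarrow> C x \<in> \<C>"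
    and sub: "\<And>x y. \<lbrakk>x \<in> S; y \<in> S; d x y < \<epsilon> x\<rbrakk> \<Longrightarrow> y \<in> C x"
    by metis
  \<comment> \<open>Half the radius, to leave room for the triangle inequality.\<close>
  define B where "B x = {y \<in> S. d x y < \<epsilon> x / 2}" for x
  have "openin (top_of_set S) (B x)" for x
  proof -
    have "openin (top_of_set S) (S \<inter> d x -` {..<\<epsilon> x / 2})"
      by (rule continuous_openin_preimage_gen[OF d_cont]) simp
    moreover have "S \<inter> d x -` {..<\<epsilon> x / 2} = B x"
      by (auto simp: B_def)
    ultimately show ?thesis
      by simp
  qed
  moreover have "S \<subseteq> (\<Union>x\<in>S. B x)"
    using \<epsilon> by (auto simp: B_def d_def)
  ultimately obtain F where F: "F \<subseteq> S" "finite F" "S \<subseteq> (\<Union>x\<in>F. B x)"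
    using S unfolding compact_eq_openin_cover
    by (smt (verit) finite_subset_image imageE)
  \<comment> \<open>The extra \<open>1\<close> keeps the minimum meaningful for empty \<open>F\<close>.\<close>
  define m where "m = Min (insert 1 (\<epsilon> ` F))"
  have m: "m > 0" "\<And>x. x \<in> F \<Longrightarrow> m \<le> \<epsilon> x"
    using F \<epsilon> by (auto simp: m_def)
  \<comment> \<open>Moving each of the coordinates by less than \<open>\<delta>\<close> changes \<open>d\<close> by less than \<open>m / 2\<close>.\<close>
  define \<delta> where "\<delta> = m / (2 * (real (card I) + 1))"
  have \<delta>: "\<delta> > 0"
    using m by (simp add: \<delta>_def)
  show ?thesis
  proof (intro exI[of _ \<delta>] conjI \<delta> ballI)
    fix x assume x: "x \<in> S"
    then obtain t where t: "t \<in> F" "d t x < \<epsilon> t / 2"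
      using F by (auto simp: B_def)
    have "y \<in> C t" if y: "y \<in> S" "\<forall>i\<in>I. \<bar>e i x - e i y\<bar> < \<delta>" for y
    proof -
      have "d x y \<le> real (card I) * \<delta>"
        unfolding d_def using y by (intro sum_bounded_above) (auto intro: less_imp_le)
      also have "\<dots> \<le> (real (card I) + 1) * \<delta>"
        using \<delta> by (intro mult_right_mono) auto
      also have "\<dots> = m / 2"
        by (simp add: \<delta>_def field_simps)
      also have "\<dots> \<le> \<epsilon> t / 2"
        using m t by simp
      finally have "d t y < \<epsilon> t"
        using d_tri[of t y x] t by linarith
      then show ?thesis
        using sub t F y by blast
    qed
    then show "\<exists>C\<in>\<C>. \<forall>y\<in>S. (\<forall>i\<in>I. \<bar>e i x - e i y\<bar> < \<delta>) \<longrightarrow> y \<in> C"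
      using C t F by blast
  qed
qed

section \<open>The mesh of iterated subdivisions\<close>

primrec Sd_iter_identification ::
  "nat \<Rightarrow> 'a set set \<Rightarrow> ('a sd_vertex \<Rightarrow> real) \<Rightarrow> ('a \<Rightarrow> real)" where
  "Sd_iter_identification 0 L x = x \<circ> Vertex"
| "Sd_iter_identification (Suc b) L x =
     Sd_iter_identification b L (Sd_identification (Sd_iter b L) x)"

text \<open>The difference of the means is the mean of \<open>a v - a w\<close> over all pairs \<open>v \<in> \<sigma>\<close>, \<open>w \<in> \<tau>\<close>. The
  diagonal pairs contribute \<open>0\<close>, which gains the factor \<open>1 - 1 / card \<tau>\<close>.\<close>

lemma abs_mean_diff_le:
  fixes a :: "'v \<Rightarrow> real"
  assumes \<tau>: "finite \<tau>" and \<sigma>: "\<sigma> \<subseteq> \<tau>" "\<sigma> \<noteq> {}" and card: "card \<tau> \<le> N"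
    and osc: "\<And>u w. \<lbrakk>u \<in> \<tau>; w \<in> \<tau>\<rbrakk> \<Longrightarrow> \<bar>a u - a w\<bar> \<le> D"
  shows "\<bar>(\<Sum>v\<in>\<sigma>. a v) / real (card \<sigma>) - (\<Sum>v\<in>\<tau>. a v) / real (card \<tau>)\<bar> \<le> (1 - 1 / real N) * D"
proof -
  have fs: "finite \<sigma>"
    using \<tau> \<sigma> finite_subset by blast
  define m n where "m = real (card \<sigma>)" and "n = real (card \<tau>)"
  have mn: "m > 0" "n > 0" "n \<le> real N"
    using \<tau> \<sigma> fs card by (auto simp: m_def n_def card_gt_0_iff)
  obtain w0 where "w0 \<in> \<tau>"
    using \<sigma> by blast
  then have D: "0 \<le> D"
    using osc[of w0 w0] by simp
  have "\<bar>\<Sum>w\<in>\<tau>. a v - a w\<bar> \<le> (n - 1) * D" if v: "v \<in> \<sigma>" for v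
  proof -
    have v': "v \<in> \<tau>"
      using v \<sigma> by blast
    have "(\<Sum>w\<in>\<tau>. a v - a w) = (\<Sum>w\<in>\<tau> - {v}. a v - a w)"
      using \<tau> v' by (simp add: sum.remove[of \<tau> v])
    also have "\<bar>\<dots>\<bar> \<le> (\<Sum>w\<in>\<tau> - {v}. \<bar>a v - a w\<bar>)"
      by (rule sum_abs)
    also have "\<dots> \<le> real (card (\<tau> - {v})) * D"
      using osc v' by (intro sum_bounded_above) auto
    also have "real (card (\<tau> - {v})) = n - 1"
      using \<tau> v' mn by (simp add: n_def card_Diff_singleton of_nat_diff Suc_le_eq card_gt_0_iff) 
    finally show ?thesis .
  qed
  then have "(\<Sum>v\<in>\<sigma>. \<bar>\<Sum>w\<in>\<tau>. a v - a w\<bar>) \<le> m * ((n - 1) * D)"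
    unfolding m_def by (rule sum_bounded_above)
  then have "\<bar>\<Sum>v\<in>\<sigma>. \<Sum>w\<in>\<tau>. a v - a w\<bar> \<le> m * ((n - 1) * D)"
    by (rule order.trans[OF sum_abs])
  moreover have "(\<Sum>v\<in>\<sigma>. \<Sum>w\<in>\<tau>. a v - a w) = n * (\<Sum>v\<in>\<sigma>. a v) - m * (\<Sum>v\<in>\<tau>. a v)"
    by (simp add: m_def n_def sum_subtractf sum_distrib_left)
  ultimately have "\<bar>n * (\<Sum>v\<in>\<sigma>. a v) - m * (\<Sum>v\<in>\<tau>. a v)\<bar> \<le> m * ((n - 1) * D)"
    by simp
  then have "\<bar>n * (\<Sum>v\<in>\<sigma>. a v) - m * (\<Sum>v\<in>\<tau>. a v)\<bar> / (m * n) \<le> (m * ((n - 1) * D)) / (m * n)"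
    using mn by (intro divide_right_mono) auto
  moreover have "\<bar>(n * (\<Sum>v\<in>\<sigma>. a v) - m * (\<Sum>v\<in>\<tau>. a v)) / (m * n)\<bar>
      = \<bar>n * (\<Sum>v\<in>\<sigma>. a v) - m * (\<Sum>v\<in>\<tau>. a v)\<bar> / (m * n)"
    using mn by (simp add: abs_mult)
  moreover have "(n * (\<Sum>v\<in>\<sigma>. a v) - m * (\<Sum>v\<in>\<tau>. a v)) / (m * n) = (\<Sum>v\<in>\<sigma>. a v) / m - (\<Sum>v\<in>\<tau>. a v) / n"
    using mn by (simp add: field_simps)
  moreover have "(m * ((n - 1) * D)) / (m * n) = (1 - 1 / n) * D"
    using mn by (simp add: field_simps)
  moreover have "(1 - 1 / n) * D \<le> (1 - 1 / real N) * D"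
    using mn D by (intro mult_right_mono) (auto simp: frac_le)
  ultimately show ?thesis
    unfolding m_def n_def by simp
qed

text \<open>The members of a chain have pairwise distinct cardinalities, all between \<open>1\<close> and \<open>N\<close>. Hence
  iterated subdivision does not raise the dimension, and one contraction factor serves all steps.\<close>

lemma card_Sd_le:
  assumes M: "finite_complex M" and card: "\<And>\<sigma>. \<sigma> \<in> M \<Longrightarrow> card \<sigma> \<le> N" and \<rho>: "\<rho> \<in> Sd M"
  shows "card \<rho> \<le> N"
proof -
  obtain C where C: "\<rho> = barycenter ` C" "C \<subseteq> M" "chain\<^sub>\<subseteq> C"
    using \<rho> by (auto simp: Sd_def)
  have inj: "inj_on card C"
  proof (rule inj_onI)
    fix \<sigma> \<tau> assume *: "\<sigma> \<in> C" "\<tau> \<in> C" "card \<sigma> = card \<tau>"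
    then have "finite \<sigma>" "finite \<tau>"
      using C finite_complexD(2)[OF M] by blast+
    moreover have "\<sigma> \<subseteq> \<tau> \<or> \<tau> \<subseteq> \<sigma>"
      using * C by (auto simp: chain_subset_def)
    ultimately show "\<sigma> = \<tau>"
      using * card_subset_eq by metis
  qed
  have "card ` C \<subseteq> {1..N}"
    using C card finite_complexD(2)[OF M] by (auto simp: Suc_le_eq card_gt_0_iff)
  then have "card C \<le> N"
    using card_inj_on_le[OF inj, of "{1..N}"] by simp
  moreover have "finite C"
    using C finite_complexD(1)[OF M] finite_subset by blast
  ultimately show ?thesis
    using C card_image_le[of C barycenter] by simp
qed

lemma card_Sd_iter_le:
  assumes L: "finite_complex L" and \<sigma>: "\<sigma> \<in> Sd_iter b L"
  shows "card \<sigma> \<le> card (\<Union>L)"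
  using \<sigma>
proof (induction b arbitrary: \<sigma>)
  case 0
  then obtain \<tau> where "\<tau> \<in> L" "\<sigma> = Vertex ` \<tau>"
    by auto
  moreover have "card \<tau> \<le> card (\<Union>L)"
    using finite_vertices[OF L] \<open>\<tau> \<in> L\<close> by (intro card_mono) auto
  ultimately show ?case
    by (simp add: card_image inj_on_def)
next
  case (Suc b)
  then show ?case
    using card_Sd_le[OF finite_complex_Sd_iter[OF L, of b]] by simp
qed

text \<open>Each coordinate of the identification is affine on simplices, with vertex values \<open>A\<close>. A
  subdivision replaces vertex values by their means over simplices, and the vertices of a new simplex
  are barycentres of nested simplices, so the oscillation of the values shrinks by a fixed factor.\<close>

lemma Sd_iter_identification_affine:
  assumes L: "finite_complex L"
  shows "\<exists>A. (\<forall>x\<in>realization (Sd_iter b L).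
        Sd_iter_identification b L x a = (\<Sum>w\<in>\<Union>(Sd_iter b L). x w * A w)) \<and>
      (\<forall>\<sigma>\<in>Sd_iter b L. \<forall>u\<in>\<sigma>. \<forall>w\<in>\<sigma>. \<bar>A u - A w\<bar> \<le> (1 - 1 / real (card (\<Union>L))) ^ b)"
proof -
  \<comment> \<open>The linear formula is proved for all \<open>x\<close> that are supported on the vertices, so that the
      induction step need not place the identified point in the realization.\<close>
  have "\<exists>A. (\<forall>x. support x \<subseteq> \<Union>(Sd_iter b L) \<longrightarrow>
        Sd_iter_identification b L x a = (\<Sum>w\<in>\<Union>(Sd_iter b L). x w * A w)) \<and>
      (\<forall>\<sigma>\<in>Sd_iter b L. \<forall>u\<in>\<sigma>. \<forall>w\<in>\<sigma>. \<bar>A u - A w\<bar> \<le> (1 - 1 / real (card (\<Union>L))) ^ b)"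
  proof (induction b)
    case 0
    let ?A = "\<lambda>w. if w = Vertex a then 1 else 0 :: real"
    have "x (Vertex a) = (\<Sum>w\<in>\<Union>(Sd_iter 0 L). x w * ?A w)"
      if "support x \<subseteq> \<Union>(Sd_iter 0 L)" for x
    proof -
      have "(\<Sum>w\<in>\<Union>(Sd_iter 0 L). x w * ?A w) =
          (if Vertex a \<in> \<Union>(Sd_iter 0 L) then x (Vertex a) else 0)"
        using sum.delta[OF finite_vertices[OF finite_complex_Sd_iter[OF L, of 0]], of "Vertex a" x]
        by (simp only: mult_1_right mult_zero_right if_distrib[of "\<lambda>t. _ * t"])
      then show ?thesis
        using that by (auto simp: support_def simp del: Sd_iter.simps)
    qed
    then show ?case
      by (intro exI[of _ ?A]) (auto simp del: Sd_iter.simps)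
  next
    case (Suc b)
    let ?M = "Sd_iter b L" and ?r = "1 - 1 / real (card (\<Union>L))"
    note M = finite_complex_Sd_iter[OF L, of b]
    note finM = finite_complexD(1)[OF M] finite_vertices[OF M]
    obtain A where lin: "\<And>x. support x \<subseteq> \<Union>?M \<Longrightarrow>
          Sd_iter_identification b L x a = (\<Sum>w\<in>\<Union>?M. x w * A w)"
      and osc: "\<And>\<sigma> u w. \<lbrakk>\<sigma> \<in> ?M; u \<in> \<sigma>; w \<in> \<sigma>\<rbrakk> \<Longrightarrow> \<bar>A u - A w\<bar> \<le> ?r ^ b"
      using Suc by metis
    \<comment> \<open>The new vertex value at the barycentre of \<open>\<sigma>\<close> is the mean of the old values over \<open>\<sigma>\<close>.\<close>
    define A' where "A' w = (let \<sigma> = inv_into ?M barycenter w in (\<Sum>v\<in>\<sigma>. A v) / real (card \<sigma>))" for w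
    have inj: "inj_on barycenter ?M"
      using finite_complexD(2)[OF M] by (auto simp: inj_on_def barycenter_eq_iff)
    have A': "A' (barycenter \<sigma>) = (\<Sum>v\<in>\<sigma>. A v) / real (card \<sigma>)" if "\<sigma> \<in> ?M" for \<sigma>
      using that inj by (simp add: A'_def)
    have vert: "\<Union>(Sd ?M) = barycenter ` ?M"
    proof
      show "barycenter ` ?M \<subseteq> \<Union>(Sd ?M)"
      proof
        fix w assume "w \<in> barycenter ` ?M"
        then obtain \<sigma> where "\<sigma> \<in> ?M" "w = barycenter \<sigma>"
          by blast
        then have "{w} \<in> Sd ?M"
          by (auto simp: Sd_def chain_subset_def intro!: exI[of _ "{\<sigma>}"])
        then show "w \<in> \<Union>(Sd ?M)"
          by blast
      qed
    qed (auto simp: Sd_def)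
    have "Sd_iter_identification (Suc b) L x a = (\<Sum>w\<in>\<Union>(Sd ?M). x w * A' w)" for x
    proof -
      have "support (Sd_identification ?M x) \<subseteq> \<Union>?M"
        unfolding support_def Sd_identification_def
        by (auto elim: sum.not_neutral_contains_not_neutral)
      then have "Sd_iter_identification (Suc b) L x a
          = (\<Sum>v\<in>\<Union>?M. Sd_identification ?M x v * A v)"
        using lin by simp
      also have "\<dots> = (\<Sum>v\<in>\<Union>?M. \<Sum>\<sigma> | \<sigma> \<in> ?M \<and> v \<in> \<sigma>. x (barycenter \<sigma>) / real (card \<sigma>) * A v)"
        by (simp add: Sd_identification_def sum_distrib_right)
      also have "\<dots> = (\<Sum>\<sigma>\<in>?M. \<Sum>v | v \<in> \<Union>?M \<and> v \<in> \<sigma>. x (barycenter \<sigma>) / real (card \<sigma>) * A v)"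
        using finM by (intro sum.swap_restrict) auto
      also have "\<dots> = (\<Sum>\<sigma>\<in>?M. x (barycenter \<sigma>) * A' (barycenter \<sigma>))"
      proof (intro sum.cong refl)
        fix \<sigma> assume s: "\<sigma> \<in> ?M"
        then have "{v. v \<in> \<Union>?M \<and> v \<in> \<sigma>} = \<sigma>"
          by auto
        then show "(\<Sum>v | v \<in> \<Union>?M \<and> v \<in> \<sigma>. x (barycenter \<sigma>) / real (card \<sigma>) * A v)
            = x (barycenter \<sigma>) * A' (barycenter \<sigma>)"
          using A'[OF s] by (simp add: sum_distrib_left sum_divide_distrib)
      qed
      also have "\<dots> = (\<Sum>w\<in>\<Union>(Sd ?M). x w * A' w)"
        unfolding vert using inj by (simp add: sum.reindex)
      finally show ?thesis .
    qed
    moreover have "\<bar>A' u - A' w\<bar> \<le> ?r ^ Suc b" if \<rho>: "\<rho> \<in> Sd ?M" "u \<in> \<rho>" "w \<in> \<rho>" for \<rho> u w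
    proof -
      have step: "\<bar>A' (barycenter \<sigma>) - A' (barycenter \<tau>)\<bar> \<le> ?r ^ Suc b"
        if "\<sigma> \<in> ?M" "\<tau> \<in> ?M" "\<sigma> \<subseteq> \<tau>" for \<sigma> \<tau>
        using abs_mean_diff_le[of \<tau> \<sigma> "card (\<Union>L)" A "?r ^ b"] that finite_complexD(2)[OF M]
          card_Sd_iter_le[OF L] osc
        by (simp add: A')
      obtain C where C: "\<rho> = barycenter ` C" "C \<subseteq> ?M" "chain\<^sub>\<subseteq> C"
        using \<rho> by (auto simp: Sd_def)
      then obtain \<sigma> \<tau> where "\<sigma> \<in> C" "\<tau> \<in> C" "u = barycenter \<sigma>" "w = barycenter \<tau>"
        using \<rho> by blast
      moreover from this have "\<sigma> \<in> ?M" "\<tau> \<in> ?M" "\<sigma> \<subseteq> \<tau> \<or> \<tau> \<subseteq> \<sigma>"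
        using C unfolding chain_subset_def by blast+
      ultimately show ?thesis
        using step abs_minus_commute by metis
    qed
    ultimately show ?case
      by (intro exI[of _ A']) simp
  qed
  then obtain A where A: "\<And>x. support x \<subseteq> \<Union>(Sd_iter b L) \<Longrightarrow>
        Sd_iter_identification b L x a = (\<Sum>w\<in>\<Union>(Sd_iter b L). x w * A w)"
    "\<forall>\<sigma>\<in>Sd_iter b L. \<forall>u\<in>\<sigma>. \<forall>w\<in>\<sigma>. \<bar>A u - A w\<bar> \<le> (1 - 1 / real (card (\<Union>L))) ^ b"
    by metis
  moreover have "support x \<subseteq> \<Union>(Sd_iter b L)" if "x \<in> realization (Sd_iter b L)" for x
    using that by (auto simp: realization_iff[OF finite_complex_Sd_iter[OF L]])
  ultimately show ?thesis
    by blast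
qed

text \<open>An affine function on a simplex oscillates no more than its values at the vertices.\<close>

lemma mesh_Sd_iter:
  assumes L: "finite_complex L" and \<sigma>: "\<sigma> \<in> Sd_iter b L"
    and x: "x \<in> realization (Sd_iter b L)" "support x \<subseteq> \<sigma>"
    and y: "y \<in> realization (Sd_iter b L)" "support y \<subseteq> \<sigma>"
  shows "\<bar>Sd_iter_identification b L x a - Sd_iter_identification b L y a\<bar>
    \<le> (1 - 1 / real (card (\<Union>L))) ^ b"
proof -
  let ?h = "Sd_iter_identification b L" and ?D = "(1 - 1 / real (card (\<Union>L))) ^ b"
  note M = finite_complex_Sd_iter[OF L, of b]
  obtain A where lin: "\<And>x. x \<in> realization (Sd_iter b L) \<Longrightarrow>
        ?h x a = (\<Sum>w\<in>\<Union>(Sd_iter b L). x w * A w)"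
    and osc: "\<And>\<sigma> u w. \<lbrakk>\<sigma> \<in> Sd_iter b L; u \<in> \<sigma>; w \<in> \<sigma>\<rbrakk> \<Longrightarrow> \<bar>A u - A w\<bar> \<le> ?D"
    using Sd_iter_identification_affine[OF L, of b a] by metis
  have fin: "finite \<sigma>" "\<sigma> \<subseteq> \<Union>(Sd_iter b L)" "finite (\<Union>(Sd_iter b L))"
    using finite_complexD(2)[OF M \<sigma>] \<sigma> finite_vertices[OF M] by auto
  have on: "?h z a = (\<Sum>w\<in>\<sigma>. z w * A w)" "(\<Sum>w\<in>\<sigma>. z w) = 1" "\<And>w. 0 \<le> z w"
    if z: "z \<in> realization (Sd_iter b L)" "support z \<subseteq> \<sigma>" for z
  proof -
    have "(\<Sum>w\<in>\<Union>(Sd_iter b L). z w * A w) = (\<Sum>w\<in>\<sigma>. z w * A w)"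
      using fin z by (intro sum.mono_neutral_right) (auto simp: support_def)
    then show "?h z a = (\<Sum>w\<in>\<sigma>. z w * A w)"
      using lin[OF z(1)] by simp
    have "(\<Sum>w\<in>\<Union>(Sd_iter b L). z w) = (\<Sum>w\<in>\<sigma>. z w)"
      using fin z by (intro sum.mono_neutral_right) (auto simp: support_def)
    then show "(\<Sum>w\<in>\<sigma>. z w) = 1" "\<And>w. 0 \<le> z w"
      using z by (auto simp: realization_iff[OF M])
  qed
  \<comment> \<open>Multiplying by sums that equal \<open>1\<close> turns the difference into a mean of \<open>A u - A w\<close>.\<close>
  have "?h x a - ?h y a = (\<Sum>u\<in>\<sigma>. x u * A u) * (\<Sum>w\<in>\<sigma>. y w) - (\<Sum>u\<in>\<sigma>. x u) * (\<Sum>w\<in>\<sigma>. y w * A w)"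
    using on[OF x] on[OF y] by simp
  also have "\<dots> = (\<Sum>u\<in>\<sigma>. \<Sum>w\<in>\<sigma>. x u * y w * (A u - A w))"
    unfolding sum_product sum_subtractf[symmetric]
    by (intro sum.cong refl) (simp add: algebra_simps)
  also have "\<bar>\<dots>\<bar> \<le> (\<Sum>u\<in>\<sigma>. \<Sum>w\<in>\<sigma>. x u * y w * ?D)"
    using on(3)[OF x] on(3)[OF y] osc[OF \<sigma>]
    by (intro order.trans[OF sum_abs] sum_mono order.trans[OF sum_abs])
      (auto simp: abs_mult intro!: mult_left_mono)
  also have "\<dots> = (\<Sum>u\<in>\<sigma>. x u) * (\<Sum>w\<in>\<sigma>. y w) * ?D"
    by (simp only: sum_product) (simp only: sum_distrib_right)
  also have "\<dots> = ?D"
    using on[OF x] on[OF y] by simp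
  finally show ?thesis .
qed

lemma Sd_iter_identification_in_realization:
  assumes L: "finite_complex L" and \<iota>: "approximations_of_identity L \<iota>"
    and x: "x \<in> realization (Sd_iter b L)"
  shows "Sd_iter_identification b L x \<in> realization L"
  using x
proof (induction b arbitrary: x)
  case 0
  note L0 = finite_complex_Sd_iter[OF L, of 0]
  have s: "support x \<in> Sd_iter 0 L" and nn: "\<And>w. 0 \<le> x w" and sum: "(\<Sum>w\<in>\<Union>(Sd_iter 0 L). x w) = 1"
    using 0 by (auto simp: realization_iff[OF L0] simp del: Sd_iter.simps)
  have "support (x \<circ> Vertex) = the_vertex ` support x"
  proof -
    obtain \<sigma> where "support x = Vertex ` \<sigma>"
      using s by auto
    moreover have "support (x \<circ> Vertex) = Vertex -` support x"
      by (auto simp: support_def)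
    ultimately show ?thesis
      by (auto simp: image_image)
  qed
  moreover have "the_vertex ` support x \<in> L"
    using s by (auto simp: image_image)
  moreover have "(\<Sum>v\<in>\<Union>L. x (Vertex v)) = 1"
  proof -
    have "\<Union>(Sd_iter 0 L) = Vertex ` \<Union>L"
      by auto
    then show ?thesis
      using sum by (simp add: sum.reindex inj_on_def)
  qed
  ultimately show ?case
    using nn unfolding Sd_iter_identification.simps realization_iff[OF L] by (auto simp: o_def)
next
  case (Suc b)
  have "Sd_identification (Sd_iter b L) x \<in> realization (Sd_iter b L)"
    using approximations_of_identityD[OF \<iota>, of b] Suc.prems
      continuous_map_in[of "top_of_set (realization (Sd (Sd_iter b L)))"
        "realization (Sd_iter b L)" "Sd_identification (Sd_iter b L)" x]
    by (simp add: simplicial_approximation_def)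
  then show ?case
    using Suc.IH by simp
qed

text \<open>The pulled-back map \<open>\<phi>\<^sub>b\<close> is a simplicial approximation of \<open>\<parallel>\<phi>\<parallel>\<close> up to the identification
  \<open>\<parallel>Sd\<^sup>b L\<parallel> \<cong> \<parallel>L\<parallel>\<close>.\<close>

lemma pullback_support:
  assumes L: "finite_complex L" and \<iota>: "approximations_of_identity L \<iota>"
    and x: "x \<in> realization (Sd_iter b L)"
  shows "pullback \<iota> \<phi> b ` support x
    \<subseteq> support (realization_map L \<phi> (Sd_iter_identification b L x))"
  using x
proof (induction b arbitrary: x)
  case 0
  then have "support x \<in> Sd_iter 0 L"
    by (simp add: realization_iff[OF finite_complex_Sd_iter[OF L]] del: Sd_iter.simps)
  then obtain \<sigma> where "support x = Vertex ` \<sigma>"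
    by auto
  then have "the_vertex ` support x \<subseteq> support (x \<circ> Vertex)"
    by (auto simp: image_image) (auto simp: support_def)
  then have "pullback \<iota> \<phi> 0 ` support x \<subseteq> \<phi> ` support (x \<circ> Vertex)"
    by (auto simp: image_subset_iff)
  moreover have "support (realization_map L \<phi> (Sd_iter_identification 0 L x)) = \<phi> ` support (x \<circ> Vertex)"
    using realization_map_support[OF L Sd_iter_identification_in_realization[OF L \<iota> 0], of \<phi>]
    by (simp only: Sd_iter_identification.simps)
  ultimately show ?case
    by (simp only:)
next
  case (Suc b)
  let ?y = "Sd_identification (Sd_iter b L) x"
  note a = approximations_of_identityD[OF \<iota>, of b] and M = finite_complex_Sd_iter[OF L, of b]
  have x: "x \<in> realization (Sd (Sd_iter b L))"
    using Suc.prems by simp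
  have "?y \<in> realization (Sd_iter b L)"
    using a x continuous_map_in[of "top_of_set (realization (Sd (Sd_iter b L)))"
        "realization (Sd_iter b L)" "Sd_identification (Sd_iter b L)" x]
    by (simp add: simplicial_approximation_def)
  then have "pullback \<iota> \<phi> b ` support ?y
      \<subseteq> support (realization_map L \<phi> (Sd_iter_identification (Suc b) L x))"
    using Suc.IH by simp
  moreover have "\<iota> (Suc b) ` support x \<subseteq> support ?y"
    by (rule simplicial_approximation_support[OF finite_complex_Sd[OF M] M a x])
  ultimately show ?case
    by (auto simp: image_subset_iff simp del: Sd_iter_identification.simps)
qed

section \<open>From open covers to covers by subcomplexes\<close>

text \<open>Two simplicial approximations of one map are contiguous: the support of \<open>F x\<close>, for \<open>x\<close> in the
  interior of \<open>\<sigma>\<close>, is a simplex that contains both images of \<open>\<sigma>\<close>.\<close>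

lemma one_contiguous_if_common_approximation:
  assumes J: "finite_complex J" and K: "finite_complex K"
    and F: "\<And>x. x \<in> realization J \<Longrightarrow> F x \<in> realization K"
    and \<phi>: "\<And>x. x \<in> realization J \<Longrightarrow> \<phi> ` support x \<subseteq> support (F x)"
    and \<psi>: "\<And>x. x \<in> realization J \<Longrightarrow> \<psi> ` support x \<subseteq> support (F x)"
  shows "one_contiguous J K \<phi> \<psi>"
proof -
  have "\<phi> ` \<sigma> \<in> K \<and> \<psi> ` \<sigma> \<in> K \<and> \<phi> ` \<sigma> \<union> \<psi> ` \<sigma> \<in> K" if \<sigma>: "\<sigma> \<in> J" for \<sigma>
  proof -
    obtain x where x: "x \<in> realization J" "support x = \<sigma>"
      using ex_point_with_support[OF J \<sigma>] .
    have "support (F x) \<in> K"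
      using F[OF x(1)] by (simp add: realization_iff[OF K])
    moreover have "\<phi> ` \<sigma> \<subseteq> support (F x)" "\<psi> ` \<sigma> \<subseteq> support (F x)"
      using \<phi>[OF x(1)] \<psi>[OF x(1)] x(2) by auto
    moreover have "\<sigma> \<noteq> {}"
      using finite_complexD(2)[OF J \<sigma>] by simp
    ultimately show ?thesis
      using finite_complexD(3)[OF K, of "support (F x)"] by simp
  qed
  then show ?thesis
    by (auto simp: one_contiguous_def simplicial_map_def facet_def)
qed

lemma mesh_ratio_tendsto_0:
  assumes L: "finite_complex L" "L \<noteq> {}" and "\<delta> > 0"
  shows "\<exists>B. \<forall>b\<ge>B. (1 - 1 / real (card (\<Union>L))) ^ b < \<delta>"
proof -
  have "\<Union>L \<noteq> {}"
    using L finite_complexD(2)[OF L(1)] by blast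
  then have "card (\<Union>L) \<ge> 1"
    using finite_vertices[OF L(1)] by (simp add: Suc_le_eq card_gt_0_iff)
  then have "\<bar>1 - 1 / real (card (\<Union>L))\<bar> < 1"
    by (auto simp: field_simps abs_if)
  then have "(\<lambda>b. (1 - 1 / real (card (\<Union>L))) ^ b) \<longlonglongrightarrow> 0"
    by (intro LIMSEQ_power_zero) simp
  from order_tendstoD(2)[OF this \<open>\<delta> > 0\<close>] show ?thesis
    by (simp add: eventually_sequentially)
qed

text \<open>Cut a homotopy \<open>H\<close> into \<open>N\<close> time steps and subdivide so finely that on each star of a vertex of
  \<open>J\<close> and during each time step \<open>H\<close> stays inside one open vertex star of \<open>K\<close>. A choice of such
  stars gives, for each time step, one vertex map that approximates \<open>H\<close> at the beginning and at the end
  of the step. Vertex maps of neighbouring steps thus approximate a common map and are contiguous.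
  The number of steps depends on \<open>H\<close> only and not on \<open>J\<close> or \<open>b\<close>.\<close>

lemma contiguous_if_homotopic:
  assumes L: "finite_complex L" "L \<noteq> {}" and K: "finite_complex K"
    and \<iota>: "approximations_of_identity L \<iota>"
    and C: "compact C" "C \<subseteq> realization L"
    and hom: "homotopic_with (\<lambda>_. True) (top_of_set C) (top_of_set (realization K))
      (realization_map L \<phi>) (realization_map L \<psi>)"
  shows "\<exists>c B. \<forall>b\<ge>B. \<forall>J. subcomplex J (Sd_iter b L) \<and>
      Sd_iter_identification b L ` realization J \<subseteq> C
    \<longrightarrow> contiguous c J K (pullback \<iota> \<phi> b) (pullback \<iota> \<psi> b)"
proof -
  obtain H where "continuous_map (prod_topology (top_of_set {0..1::real}) (top_of_set C))
        (top_of_set (realization K)) H"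
    and H01: "\<And>x. H (0, x) = realization_map L \<phi> x" "\<And>x. H (1, x) = realization_map L \<psi> x"
    using hom unfolding homotopic_with_def by auto
  then have H: "continuous_on ({0..1} \<times> C) H" "H ` ({0..1} \<times> C) \<subseteq> realization K"
    by auto
  define T where "T = {0..1::real} \<times> C"
  \<comment> \<open>The time \<open>None\<close> and the vertex coordinates \<open>Some v\<close> separate the points of \<open>T\<close>.\<close>
  define e where "e i p = (case i of None \<Rightarrow> fst p | Some v \<Rightarrow> snd p v)"
    for i and p :: "real \<times> ('a \<Rightarrow> real)"
  \<comment> \<open>The preimages under \<open>H\<close> of the open vertex stars of \<open>K\<close>; they form an open cover.\<close>
  define W where "W w = {p \<in> T. H p w \<in> - {0}}" for w
  have HK: "H p \<in> realization K" if "p \<in> T" for p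
    using H that by (auto simp: T_def)
  have "compact T"
    unfolding T_def by (intro compact_Times C) auto
  moreover have "finite (insert None (Some ` \<Union>L))"
    using finite_vertices[OF L(1)] by simp
  moreover have "continuous_on T (e i)" for i
  proof (cases i)
    case None
    then show ?thesis
      by (simp add: e_def[abs_def] continuous_on_fst continuous_on_id)
  next
    case (Some v)
    have "continuous_on T (\<lambda>p. snd p v)"
      by (rule continuous_on_product_then_coordinatewise[OF continuous_on_snd[OF continuous_on_id]])
    then show ?thesis
      using Some by (simp add: e_def[abs_def])
  qed
  moreover have "p = q" if pq: "p \<in> T" "q \<in> T" "\<forall>i\<in>insert None (Some ` \<Union>L). e i p = e i q" for p q
  proof -
    have "snd p v = snd q v" for v
    proof (cases "v \<in> \<Union>L")
      case True
      then show ?thesis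
        using pq by (auto simp: e_def)
    next
      case False
      have "snd p \<in> realization L" "snd q \<in> realization L"
        using pq C by (auto simp: T_def)
      then show ?thesis
        using False realization_coordinate_eq_0[OF L(1)] by metis
    qed
    moreover have "fst p = fst q"
      using pq by (simp add: e_def)
    ultimately show ?thesis
      by (auto simp: prod_eq_iff)
  qed
  moreover have "T \<subseteq> \<Union>(range W)"
  proof
    fix p assume p: "p \<in> T"
    have "support (H p) \<noteq> {}"
      using HK[OF p] finite_complexD(2)[OF K] by (auto simp: realization_iff[OF K])
    then show "p \<in> \<Union>(range W)"
      using p by (auto simp: W_def support_def)
  qed
  moreover have "openin (top_of_set T) D" if D: "D \<in> range W" for D
  proof -
    obtain w where w: "D = W w"
      using D by blast
    have "continuous_on T (\<lambda>p. H p w)"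
      using H(1) unfolding T_def by (rule continuous_on_product_then_coordinatewise)
    then have "openin (top_of_set T) (T \<inter> (\<lambda>p. H p w) -` (- {0}))"
      by (rule continuous_openin_preimage_gen) auto
    moreover have "T \<inter> (\<lambda>p. H p w) -` (- {0}) = W w"
      by (auto simp: W_def)
    ultimately show ?thesis
      using w by simp
  qed
  ultimately have "\<exists>\<delta>>0. \<forall>p\<in>T. \<exists>D\<in>range W. \<forall>q\<in>T.
      (\<forall>i\<in>insert None (Some ` \<Union>L). \<bar>e i p - e i q\<bar> < \<delta>) \<longrightarrow> q \<in> D"
    by (rule Lebesgue_number_coordinates)
  then obtain \<delta> where \<delta>: "\<delta> > 0"
    and near: "\<And>p. p \<in> T \<Longrightarrow> \<exists>D\<in>range W. \<forall>q\<in>T.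
      (\<forall>i\<in>insert None (Some ` \<Union>L). \<bar>e i p - e i q\<bar> < \<delta>) \<longrightarrow> q \<in> D"
    by blast
  have near': "\<exists>w. \<forall>s y. s \<in> {0..1} \<and> y \<in> C \<and> \<bar>t - s\<bar> < \<delta> \<and> (\<forall>v\<in>\<Union>L. \<bar>z v - y v\<bar> < \<delta>)
      \<longrightarrow> w \<in> support (H (s, y))" if tz: "t \<in> {0..1}" "z \<in> C" for t z
  proof -
    have "(t, z) \<in> T"
      using tz by (simp add: T_def)
    then obtain w where w: "\<And>q. \<lbrakk>q \<in> T; \<forall>i\<in>insert None (Some ` \<Union>L). \<bar>e i (t, z) - e i q\<bar> < \<delta>\<rbrakk>
        \<Longrightarrow> q \<in> W w"
      using near by blast
    have "w \<in> support (H (s, y))"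
      if "s \<in> {0..1}" "y \<in> C" "\<bar>t - s\<bar> < \<delta>" "\<forall>v\<in>\<Union>L. \<bar>z v - y v\<bar> < \<delta>" for s y
      using w[of "(s, y)"] that by (auto simp: e_def T_def W_def support_def)
    then show ?thesis
      by blast
  qed
  obtain n where n: "inverse (real (Suc n)) < \<delta>"
    using reals_Archimedean[OF \<delta>] by blast
  define N where "N = Suc n"
  have N: "N > 0" "1 / real N < \<delta>"
    using n by (simp_all add: N_def inverse_eq_divide)
  obtain B where B: "\<And>b. b \<ge> B \<Longrightarrow> (1 - 1 / real (card (\<Union>L))) ^ b < \<delta>"
    using mesh_ratio_tendsto_0[OF L \<delta>] by blast
  show ?thesis
  proof (rule exI[of _ "Suc N"], rule exI[of _ B], intro allI impI, elim conjE)
    fix b J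
    assume b: "b \<ge> B" and J: "subcomplex J (Sd_iter b L)"
      and im: "Sd_iter_identification b L ` realization J \<subseteq> C"
    have JC: "Sd_iter_identification b L x \<in> C" if "x \<in> realization J" for x
      using im that by blast
    let ?h = "Sd_iter_identification b L"
    let ?t = "\<lambda>i. real i / real N"
    have JM: "J \<subseteq> Sd_iter b L" and fJ: "finite_complex J"
      using J by (auto simp: subcomplex_def)
    have xM: "x \<in> realization (Sd_iter b L)" if "x \<in> realization J" for x
      using realization_subcomplex[OF J] that by blast
    define F where "F i x = H (?t i, ?h x)" for i x
    define approx where "approx i \<theta> \<longleftrightarrow> (\<forall>x\<in>realization J. \<theta> ` support x \<subseteq> support (F i x))"
      for i and \<theta> :: "'a sd_vertex \<Rightarrow> 'b"
    have "\<exists>w. \<forall>x\<in>realization J. v \<in> support x \<longrightarrow> w \<in> support (F i x) \<and> w \<in> support (F (Suc i) x)"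
      if i: "i < N" and v: "v \<in> \<Union>J" for i v
    proof -
      obtain \<sigma> where "\<sigma> \<in> J" "v \<in> \<sigma>"
        using v by blast
      \<comment> \<open>The vertex \<open>v\<close> itself, as a point \<open>z\<close>, is within the mesh of every point of its star.\<close>
      then have "{v} \<in> J"
        using finite_complexD(3)[OF fJ, of \<sigma> "{v}"] by simp
      then obtain z where z: "z \<in> realization J" "support z = {v}"
        using ex_point_with_support[OF fJ] by blast
      have t: "?t i \<in> {0..1}" "?t (Suc i) \<in> {0..1}"
        using i N by (auto simp: divide_simps)
      have d: "\<bar>?t i - ?t i\<bar> < \<delta>" "\<bar>?t i - ?t (Suc i)\<bar> < \<delta>"
        using \<delta> N by (simp_all add: diff_divide_distrib[symmetric])
      obtain w where w: "\<And>s y. \<lbrakk>s \<in> {0..1}; y \<in> C; \<bar>?t i - s\<bar> < \<delta>; \<forall>a\<in>\<Union>L. \<bar>?h z a - y a\<bar> < \<delta>\<rbrakk>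
          \<Longrightarrow> w \<in> support (H (s, y))"
        using near'[OF t(1) JC[OF z(1)]] by blast
      have "w \<in> support (F i x) \<and> w \<in> support (F (Suc i) x)"
        if x: "x \<in> realization J" "v \<in> support x" for x
      proof -
        have "support x \<in> Sd_iter b L"
          using xM[OF x(1)] by (simp add: realization_iff[OF finite_complex_Sd_iter[OF L(1)]])
        then have "\<bar>?h z a - ?h x a\<bar> \<le> (1 - 1 / real (card (\<Union>L))) ^ b" for a
          using mesh_Sd_iter[OF L(1) _ xM[OF z(1)] _ xM[OF x(1)]] z(2) x(2) by simp
        then have "\<bar>?h z a - ?h x a\<bar> < \<delta>" for a
          using B[OF b] order.strict_trans1 by blast
        then show ?thesis
          unfolding F_def using w t d JC[OF x(1)] by blast
      qed
      then show ?thesis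
        by blast
    qed
    then obtain \<zeta> where \<zeta>: "\<And>i v x. \<lbrakk>i < N; v \<in> \<Union>J; x \<in> realization J; v \<in> support x\<rbrakk>
        \<Longrightarrow> \<zeta> i v \<in> support (F i x) \<and> \<zeta> i v \<in> support (F (Suc i) x)"
      by metis
    have sub: "support x \<subseteq> \<Union>J" if "x \<in> realization J" for x
      using that by (auto simp: realization_iff[OF fJ])
    have ap\<zeta>: "approx i (\<zeta> i)" "approx (Suc i) (\<zeta> i)" if "i < N" for i
      using \<zeta>[OF that] sub by (fastforce simp: approx_def)+
    have ap0: "approx 0 (pullback \<iota> \<phi> b)"
      unfolding approx_def F_def using pullback_support[OF L(1) \<iota>, where \<phi> = \<phi>] xM by (simp add: H01)
    have apN: "approx N (pullback \<iota> \<psi> b)"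
      unfolding approx_def F_def using pullback_support[OF L(1) \<iota>, where \<phi> = \<psi>] xM N by (simp add: H01)
    \<comment> \<open>A chain of \<open>N + 1\<close> contiguities: \<open>\<theta> i\<close> and \<open>\<theta> (Suc i)\<close> both approximate
        \<open>F i\<close>.\<close>
    define \<theta> where "\<theta> i = (if i = 0 then pullback \<iota> \<phi> b
        else if i \<le> N then \<zeta> (i - 1) else pullback \<iota> \<psi> b)" for i
    have "one_contiguous J K (\<theta> i) (\<theta> (Suc i))" if "i < Suc N" for i
    proof (rule one_contiguous_if_common_approximation[OF fJ K])
      have "approx i (\<theta> i)"
        using that ap\<zeta>(2)[of "i - 1"] ap0 by (cases i) (auto simp: \<theta>_def)
      moreover have "approx i (\<theta> (Suc i))"
        using that ap\<zeta>(1)[of i] apN by (cases "i = N") (auto simp: \<theta>_def)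
      ultimately show "\<theta> i ` support x \<subseteq> support (F i x)" "\<theta> (Suc i) ` support x \<subseteq> support (F i x)"
        if "x \<in> realization J" for x
        using that by (auto simp: approx_def)
      show "F i x \<in> realization K" if x: "x \<in> realization J" for x
        unfolding F_def using JC[OF x] \<open>i < Suc N\<close> N
        by (intro HK) (auto simp: T_def divide_simps)
    qed
    then show "contiguous (Suc N) J K (pullback \<iota> \<phi> b) (pullback \<iota> \<psi> b)"
      unfolding contiguous_def by (intro conjI exI[of _ \<theta>]) (auto simp: \<theta>_def)
  qed
qed

text \<open>The open sets are first shrunk to compact sets \<open>C U\<close>, to have uniform estimates for the
  homotopies. If the mesh is small, every simplex of the subdivision is mapped into some \<open>C U\<close>, and
  the simplices mapped into \<open>C U\<close> form a subcomplex on which the two maps are contiguous.\<close>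

lemma subcomplex_cover_of_open_cover:
  assumes L: "finite_complex L" "L \<noteq> {}" and K: "finite_complex K"
    and \<iota>: "approximations_of_identity L \<iota>"
    and fin: "finite \<U>" and cov: "\<Union>\<U> = realization L"
    and U: "\<And>U. U \<in> \<U> \<Longrightarrow> openin (top_of_set (realization L)) U \<and>
      homotopic_with (\<lambda>_. True) (subtopology (top_of_set (realization L)) U)
        (top_of_set (realization K)) (realization_map L \<phi>) (realization_map L \<psi>)"
  shows "\<exists>c B. \<forall>b\<ge>B. \<exists>\<J>. finite \<J> \<and> card \<J> \<le> card \<U> \<and> \<Union>\<J> = Sd_iter b L \<and>
    (\<forall>J\<in>\<J>. subcomplex J (Sd_iter b L) \<and> contiguous c J K (pullback \<iota> \<phi> b) (pullback \<iota> \<psi> b))"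
proof -
  let ?X = "realization L" and ?r = "1 - 1 / real (card (\<Union>L))"
  note finV = finite_vertices[OF L(1)]
  have X: "compact ?X"
    by (rule compact_realization[OF L(1)])
  have coord: "continuous_on S (\<lambda>x::'a \<Rightarrow> real. x v)" for S v
    by (rule continuous_on_subset[OF continuous_on_product_coordinates]) auto
  have sep: "x = y" if "x \<in> ?X" "y \<in> ?X" "\<forall>v\<in>\<Union>L. x v = y v" for x y
  proof
    fix v show "x v = y v"
    proof (cases "v \<in> \<Union>L")
      case True
      then show ?thesis
        using that(3) by blast
    next
      case False
      then show ?thesis
        using realization_coordinate_eq_0[OF L(1)] that(1,2) by metis
    qed
  qed
  have "\<exists>\<epsilon>>0. \<forall>x\<in>?X. \<exists>U\<in>\<U>. \<forall>y\<in>?X. (\<forall>v\<in>\<Union>L. \<bar>x v - y v\<bar> < \<epsilon>) \<longrightarrow> y \<in> U"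
    by (rule Lebesgue_number_coordinates[OF X finV coord sep]) (use cov U in simp_all)
  then obtain \<epsilon> where \<epsilon>: "\<epsilon> > 0"
    and Leb: "\<And>x. x \<in> ?X \<Longrightarrow> \<exists>U\<in>\<U>. \<forall>y\<in>?X. (\<forall>v\<in>\<Union>L. \<bar>x v - y v\<bar> < \<epsilon>) \<longrightarrow> y \<in> U"
    by blast
  \<comment> \<open>Each point outside \<open>U\<close> differs from each point of \<open>C U\<close> by at least \<open>\<epsilon> / 2\<close> in a coordinate.\<close>
  define C where "C U = {x \<in> ?X. \<forall>y\<in>?X. (\<forall>v\<in>\<Union>L. \<bar>x v - y v\<bar> < \<epsilon> / 2) \<longrightarrow> y \<in> U}" for U
  have C_sub: "C U \<subseteq> ?X" "C U \<subseteq> U" for U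
    using \<epsilon> by (auto simp: C_def)
  have "compact (C U)" for U
  proof -
    define G where "G y = (\<Inter>v\<in>\<Union>L. {x. \<bar>x v - y v\<bar> < \<epsilon> / 2})" for y :: "'a \<Rightarrow> real"
    have "open (G y)" for y
      unfolding G_def using finV
      by (intro open_INT ballI open_Collect_less continuous_intros coord) auto
    then have "closed (- (\<Union>y\<in>?X - U. G y))"
      by auto
    moreover have "C U = ?X \<inter> - (\<Union>y\<in>?X - U. G y)"
      by (auto simp: C_def G_def)
    ultimately show ?thesis
      using compact_Int_closed[OF X] by simp
  qed
  moreover have "homotopic_with (\<lambda>_. True) (top_of_set (C U)) (top_of_set (realization K))
      (realization_map L \<phi>) (realization_map L \<psi>)" if "U \<in> \<U>" for U
  proof -
    have "?X \<inter> U \<inter> C U = C U"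
      using C_sub[of U] by blast
    then show ?thesis
      using homotopic_from_subtopology[of _ "subtopology (top_of_set ?X) U" _ _ _ "C U"] U[OF that]
      by (metis subtopology_subtopology)
  qed
  ultimately have "\<exists>c B. \<forall>b\<ge>B. \<forall>J. subcomplex J (Sd_iter b L) \<and>
      Sd_iter_identification b L ` realization J \<subseteq> C U
    \<longrightarrow> contiguous c J K (pullback \<iota> \<phi> b) (pullback \<iota> \<psi> b)" if "U \<in> \<U>" for U
    using contiguous_if_homotopic[OF L K \<iota> _ C_sub(1), of U] that by blast
  then obtain c B where cB: "\<And>U b J. \<lbrakk>U \<in> \<U>; b \<ge> B U; subcomplex J (Sd_iter b L);
      Sd_iter_identification b L ` realization J \<subseteq> C U\<rbrakk>
    \<Longrightarrow> contiguous (c U) J K (pullback \<iota> \<phi> b) (pullback \<iota> \<psi> b)"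
    by metis
  obtain B0 where B0: "\<And>b. b \<ge> B0 \<Longrightarrow> ?r ^ b < \<epsilon> / 2"
    using mesh_ratio_tendsto_0[OF L, of "\<epsilon> / 2"] \<epsilon> by auto
  \<comment> \<open>The value \<open>0\<close> serves the case of empty \<open>\<U>\<close>, and \<open>B0\<close> secures the mesh bound.\<close>
  define c' B' where "c' = Max (insert 0 (c ` \<U>))" and "B' = Max (insert B0 (B ` \<U>))"
  show ?thesis
  proof (rule exI[of _ c'], rule exI[of _ B'], intro allI impI)
    fix b assume b: "b \<ge> B'"
    let ?M = "Sd_iter b L" and ?h = "Sd_iter_identification b L"
    note M = finite_complex_Sd_iter[OF L(1), of b]
    define J where "J U = {\<sigma> \<in> ?M. \<forall>x\<in>realization ?M. support x \<subseteq> \<sigma> \<longrightarrow> ?h x \<in> C U}" for U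
    have J: "subcomplex (J U) ?M" for U
      using finite_complexD[OF M] unfolding subcomplex_def finite_complex_def J_def
      by (auto intro: finite_subset)
    have "contiguous c' (J U) K (pullback \<iota> \<phi> b) (pullback \<iota> \<psi> b)" if "U \<in> \<U>" for U
    proof (rule contiguous_mono)
      show "contiguous (c U) (J U) K (pullback \<iota> \<phi> b) (pullback \<iota> \<psi> b)"
      proof (rule cB[OF that _ J])
        show "B U \<le> b"
          using b that fin by (simp add: B'_def)
        show "?h ` realization (J U) \<subseteq> C U"
        proof (rule image_subsetI)
          fix x assume x: "x \<in> realization (J U)"
          then have "support x \<in> J U" "x \<in> realization ?M"
            using J[of U] realization_subcomplex[OF J[of U]] realization_iff[of "J U" x]
            by (auto simp: subcomplex_def)
          then show "?h x \<in> C U"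
            by (auto simp: J_def)
        qed
      qed
      show "c U \<le> c'"
        using that fin by (simp add: c'_def)
    qed
    moreover have "\<Union>(J ` \<U>) = ?M"
    proof (intro equalityI subsetI)
      fix \<sigma> assume \<sigma>: "\<sigma> \<in> ?M"
      obtain z where z: "z \<in> realization ?M" "support z = \<sigma>"
        using ex_point_with_support[OF M \<sigma>] .
      have hX: "?h x \<in> ?X" if "x \<in> realization ?M" for x
        by (rule Sd_iter_identification_in_realization[OF L(1) \<iota> that])
      obtain U where U: "U \<in> \<U>" "\<And>y. \<lbrakk>y \<in> ?X; \<forall>v\<in>\<Union>L. \<bar>?h z v - y v\<bar> < \<epsilon>\<rbrakk> \<Longrightarrow> y \<in> U"
        using Leb[OF hX[OF z(1)]] by blast
      have "?h x \<in> C U" if x: "x \<in> realization ?M" "support x \<subseteq> \<sigma>" for x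
      proof -
        have "y \<in> U" if y: "y \<in> ?X" "\<forall>v\<in>\<Union>L. \<bar>?h x v - y v\<bar> < \<epsilon> / 2" for y
        proof (rule U(2)[OF y(1)], rule ballI)
          fix v assume v: "v \<in> \<Union>L"
          have "\<bar>?h z v - ?h x v\<bar> \<le> ?r ^ b"
            using mesh_Sd_iter[OF L(1) \<sigma> z(1) _ x] z(2) by simp
          moreover have "?r ^ b < \<epsilon> / 2"
            using b fin by (intro B0) (simp add: B'_def)
          moreover have "\<bar>?h x v - y v\<bar> < \<epsilon> / 2"
            using y v by blast
          ultimately show "\<bar>?h z v - y v\<bar> < \<epsilon>"
            by linarith
        qed
        then show ?thesis
          using hX[OF x(1)] by (auto simp: C_def)
      qed
      then show "\<sigma> \<in> \<Union>(J ` \<U>)"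
        using U(1) \<sigma> by (auto simp: J_def)
    qed (auto simp: J_def)
    ultimately show "\<exists>\<J>. finite \<J> \<and> card \<J> \<le> card \<U> \<and> \<Union>\<J> = ?M \<and>
        (\<forall>J\<in>\<J>. subcomplex J ?M \<and> contiguous c' J K (pullback \<iota> \<phi> b) (pullback \<iota> \<psi> b))"
      using fin card_image_le[OF fin, of J] J by (intro exI[of _ "J ` \<U>"]) auto
  qed
qed

section \<open>The two distances\<close>

lemma enat_diff_mono_1:
  fixes m n :: enat
  assumes "m \<le> n"
  shows "m - 1 \<le> n - 1"
  using assms by (cases m; cases n) (auto simp: one_enat_def)

lemma strict_contiguity_distance_at_antimono:
  assumes "c \<le> d"
  shows "strict_contiguity_distance_at d L K \<phi> \<psi> \<le> strict_contiguity_distance_at c L K \<phi> \<psi>"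
  unfolding strict_contiguity_distance_at_def using contiguous_mono[OF _ assms]
  by (intro enat_diff_mono_1 Inf_superset_mono) blast

lemma homotopic_distance_le_strict_contiguity_distance_at:
  assumes L: "finite_complex L" and K: "finite_complex K" and \<iota>: "approximations_of_identity L \<iota>"
    and \<phi>: "simplicial_map L K \<phi>" and \<psi>: "simplicial_map L K \<psi>"
  shows "homotopic_distance (top_of_set (realization L)) (top_of_set (realization K))
      (realization_map L \<phi>) (realization_map L \<psi>)
    \<le> strict_contiguity_distance_at c (Sd_iter b L) K (pullback \<iota> \<phi> b) (pullback \<iota> \<psi> b)"
  unfolding homotopic_distance_def strict_contiguity_distance_at_def
proof (rule enat_diff_mono_1, rule Inf_greatest, clarify)
  fix \<J> assume "finite \<J>" "\<Union>\<J> = Sd_iter b L"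
    "\<forall>J\<in>\<J>. subcomplex J (Sd_iter b L) \<and> contiguous c J K (pullback \<iota> \<phi> b) (pullback \<iota> \<psi> b)"
  then obtain \<U> where "finite \<U>" "card \<U> \<le> card \<J>" "\<Union>\<U> = realization L"
    "\<forall>U\<in>\<U>. openin (top_of_set (realization L)) U \<and>
      homotopic_with (\<lambda>_. True) (subtopology (top_of_set (realization L)) U)
        (top_of_set (realization K)) (realization_map L \<phi>) (realization_map L \<psi>)"
    using open_cover_of_subcomplex_cover[OF L K \<iota> \<phi> \<psi>, of \<J> b c] by blast
  then show "Inf {enat (card \<U>) |\<U>. finite \<U> \<and> \<Union>\<U> = topspace (top_of_set (realization L)) \<and>
      (\<forall>U\<in>\<U>. openin (top_of_set (realization L)) U \<and>
        homotopic_with (\<lambda>_. True) (subtopology (top_of_set (realization L)) U)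
          (top_of_set (realization K)) (realization_map L \<phi>) (realization_map L \<psi>))}
      \<le> enat (card \<J>)"
    by (intro Inf_lower2[of "enat (card \<U>)"]) auto
qed

lemma strict_contiguity_distance_at_le_homotopic_distance:
  assumes L: "finite_complex L" "L \<noteq> {}" and K: "finite_complex K"
    and \<iota>: "approximations_of_identity L \<iota>"
  shows "\<exists>c B. \<forall>b\<ge>B.
    strict_contiguity_distance_at c (Sd_iter b L) K (pullback \<iota> \<phi> b) (pullback \<iota> \<psi> b)
    \<le> homotopic_distance (top_of_set (realization L)) (top_of_set (realization K))
      (realization_map L \<phi>) (realization_map L \<psi>)"
proof -
  let ?A = "{enat (card \<U>) |\<U>. finite \<U> \<and> \<Union>\<U> = topspace (top_of_set (realization L)) \<and>
      (\<forall>U\<in>\<U>. openin (top_of_set (realization L)) U \<and>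
        homotopic_with (\<lambda>_. True) (subtopology (top_of_set (realization L)) U)
          (top_of_set (realization K)) (realization_map L \<phi>) (realization_map L \<psi>))}"
  show ?thesis
  proof (cases "?A = {}")
    case True
    then have "homotopic_distance (top_of_set (realization L)) (top_of_set (realization K))
        (realization_map L \<phi>) (realization_map L \<psi>) = \<infinity>"
      unfolding homotopic_distance_def by (simp only: Inf_empty top_enat_def idiff_infinity)
    then show ?thesis
      by simp
  next
    case False
    have "Inf A \<in> A" if "A \<noteq> {}" for A :: "enat set"
      using that wellorder_InfI[of _ A] by blast
    then have "Inf ?A \<in> ?A"
      using False by (simp only: simp_thms)
    then obtain \<U> where \<U>: "Inf ?A = enat (card \<U>)" "finite \<U>" "\<Union>\<U> = realization L"
      "\<And>U. U \<in> \<U> \<Longrightarrow> openin (top_of_set (realization L)) U \<and>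
        homotopic_with (\<lambda>_. True) (subtopology (top_of_set (realization L)) U)
          (top_of_set (realization K)) (realization_map L \<phi>) (realization_map L \<psi>)"
      by auto
    have "\<exists>c B. \<forall>b\<ge>B. \<exists>\<J>. finite \<J> \<and> card \<J> \<le> card \<U> \<and> \<Union>\<J> = Sd_iter b L \<and>
        (\<forall>J\<in>\<J>. subcomplex J (Sd_iter b L) \<and>
          contiguous c J K (pullback \<iota> \<phi> b) (pullback \<iota> \<psi> b))"
      by (rule subcomplex_cover_of_open_cover[OF L K \<iota> \<U>(2-4)])
    then obtain c B where cB: "\<And>b. b \<ge> B \<Longrightarrow> \<exists>\<J>. finite \<J> \<and> card \<J> \<le> card \<U> \<and>
        \<Union>\<J> = Sd_iter b L \<and> (\<forall>J\<in>\<J>. subcomplex J (Sd_iter b L) \<and>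
          contiguous c J K (pullback \<iota> \<phi> b) (pullback \<iota> \<psi> b))"
      by blast
    show ?thesis
    proof (rule exI[of _ c], rule exI[of _ B], intro allI impI)
      fix b assume "b \<ge> B"
      then obtain \<J> where \<J>: "finite \<J>" "card \<J> \<le> card \<U>" "\<Union>\<J> = Sd_iter b L"
        "\<forall>J\<in>\<J>. subcomplex J (Sd_iter b L) \<and> contiguous c J K (pullback \<iota> \<phi> b) (pullback \<iota> \<psi> b)"
        using cB by blast
      show "strict_contiguity_distance_at c (Sd_iter b L) K (pullback \<iota> \<phi> b) (pullback \<iota> \<psi> b)
        \<le> homotopic_distance (top_of_set (realization L)) (top_of_set (realization K))
          (realization_map L \<phi>) (realization_map L \<psi>)"
        unfolding homotopic_distance_def strict_contiguity_distance_at_def \<U>(1)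
        using \<J> by (intro enat_diff_mono_1 Inf_lower2[of "enat (card \<J>)"]) auto
    qed
  qed
qed

theorem theorem3p3:
  fixes L :: "'a set set" and K :: "'b set set" and \<phi> \<phi>' :: "'a \<Rightarrow> 'b"
    and \<iota> :: "nat \<Rightarrow> 'a sd_vertex \<Rightarrow> 'a sd_vertex"
  assumes "finite_complex L" "connected_complex L"
    and "finite_complex K" "connected_complex K"
    and "simplicial_map L K \<phi>" "simplicial_map L K \<phi>'"
    and "approximations_of_identity L \<iota>"
  shows "homotopic_distance (top_of_set (realization L)) (top_of_set (realization K))
           (realization_map L \<phi>) (realization_map L \<phi>')
         = contiguity_distance \<iota> L K \<phi> \<phi>'"
proof -
  let ?D = "homotopic_distance (top_of_set (realization L)) (top_of_set (realization K))
           (realization_map L \<phi>) (realization_map L \<phi>')"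
  let ?S = "\<lambda>b c. strict_contiguity_distance_at c (Sd_iter b L) K (pullback \<iota> \<phi> b) (pullback \<iota> \<phi>' b)"
  have "L \<noteq> {}"
    using assms(2) by (simp add: connected_complex_def)
  then have "\<exists>c B. \<forall>b\<ge>B. ?S b c \<le> ?D"
    by (rule strict_contiguity_distance_at_le_homotopic_distance[OF assms(1) _ assms(3,7)])
  then obtain c0 B where up: "\<And>b. b \<ge> B \<Longrightarrow> ?S b c0 \<le> ?D"
    by blast
  have lo: "?D \<le> ?S b c" for b c
    by (rule homotopic_distance_le_strict_contiguity_distance_at[OF assms(1,3,7,5,6)])
  have eq: "?S b c = ?D" if "b \<ge> B" "c \<ge> c0" for b c
    using up[OF that(1)] lo[of c b] strict_contiguity_distance_at_antimono[OF that(2)]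
    by (meson order.antisym order.trans)
  have "strict_contiguity_distance (Sd_iter b L) K (pullback \<iota> \<phi> b) (pullback \<iota> \<phi>' b) = ?D"
    if "b \<ge> B" for b
    unfolding strict_contiguity_distance_def using eq[OF that]
    by (intro limI tendsto_eventually eventually_sequentiallyI)
  then show ?thesis
    unfolding contiguity_distance_def
    by (intro limI[symmetric] tendsto_eventually eventually_sequentiallyI)
qed

end
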